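(* Consider the Yule (1925) nested model with parameters $g>0$, $s>0$ and present time $T>0$ (defined in the context). Let $N_T$ be the number of genera at time $T$, labeled $0,1,\dots,N_T-1$ in the planar order described in the context (genus $0$ being the primordial genus), and for each $i$ let $A_i$ be the age at time $T$ of genus $i$ (time $T$ minus its birth time) and $S_i$ its size (number of species it contains at time $T$). Let $(A,S)$ be a random pair such that $A$ is exponentially distributed with parameter $g$ and, for every $a>0$ and $k\ge 1$, $$\mathbb P(S=k\mid A=a)=\mathbb P(Y_a=k)=e^{-sa}(1-e^{-sa})^{k-1},$$ where $(Y_t)_{t\ge0}$ is a pure-birth (Yule) process with rate $s$ started at $Y_0=1$; equivalently $$\mathbb P(S=k,\,A\in da)=g\,e^{-(g+s)a}(1-e^{-sa})^{k-1}\,da,\qquad a>0,\ k\ge 1.$$ Then the sequence $((A_i,S_i))_{1\le i\le N_T-1}$ of ages and sizes of the derived genera is distributed as an i.i.d. sequence of copies of $(A,S)$ killed at the first index whose first component exceeds $T$. Precisely: if $((A'_j,S'_j))_{j\ge1}$ are i.i.d. copies of $(A,S)$ and $K:=\min\{j\ge1: A'_j>T\}$, then $\big(N_T-1,\,((A_i,S_i))_{1\le i\le N_T-1}\big)$ has the same law as $\big(K-1,\,((A'_j,S'_j))_{1\le j\le K-1}\big)$.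
   Context: Yule (1925) nested model: at time $0$ there is one genus (the primordial genus) containing one species. Each genus, independently of everything else, gives birth at rate $g$ to a new (daughter) genus, which at birth contains exactly one species; the mother genus's species count is unaffected by this event. Within each genus, independently, species give birth at rate $s$ each, so the number of species in a genus of age $t$ evolves as a pure-birth (Yule) process with rate $s$ started at $1$. Nothing ever goes extinct. The process is observed at time $T$. Planar order of genera: the genealogical tree of genera (each genus attached to its mother at its birth time) is ordered recursively depth-first as follows: a genus comes first, followed by the ordered lists of the subtrees of its daughter genera, taken in order of decreasing birth time (the most recently born daughter's subtree first). Restricting this order to the genera present at time $T$ gives the labels $0,1,\dots,N_T-1$, the primordial genus receiving label $0$. *)

theory Defs
  imports "HOL-Probability.Probability"
begin

text \<open>Genera are addressed by Ulam--Harris words (nat lists): the empty list is the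
primordial genus, and p @ [n] is the n-th daughter (0-indexed, in order of birth) of genus p.
E p m is the m-th inter-birth time of daughters of genus p (so daughter n of p is born at
birth p + sum of E p m for m \<le> n).  H u k is the holding time of the species Yule process
of genus u in state k+1.\<close>

fun birth_from :: "(nat list \<Rightarrow> nat \<Rightarrow> real) \<Rightarrow> nat list \<Rightarrow> nat list \<Rightarrow> real" where
  "birth_from E p [] = 0"
| "birth_from E p (n # v) = (\<Sum>m\<le>n. E p m) + birth_from E (p @ [n]) v"

definition genus_birth :: "(nat list \<Rightarrow> nat \<Rightarrow> real) \<Rightarrow> nat list \<Rightarrow> real" where
  "genus_birth E u = birth_from E [] u"

definition present_genera :: "(nat list \<Rightarrow> nat \<Rightarrow> real) \<Rightarrow> real \<Rightarrow> nat list set" where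
  "present_genera E T = {u. genus_birth E u \<le> T}"

text \<open>Planar (depth-first) order: a genus precedes its proper descendants; subtrees of
daughters come in order of decreasing birth time, i.e. decreasing daughter index.\<close>
definition planar_before :: "nat list \<Rightarrow> nat list \<Rightarrow> bool" where
  "planar_before u v \<longleftrightarrow>
     (\<exists>w. w \<noteq> [] \<and> v = u @ w) \<or>
     (\<exists>w a b x y. u = w @ a # x \<and> v = w @ b # y \<and> b < a)"

definition num_genera :: "(nat list \<Rightarrow> nat \<Rightarrow> real) \<Rightarrow> real \<Rightarrow> nat" where
  "num_genera E T = card (present_genera E T)"

definition genus_label :: "(nat list \<Rightarrow> nat \<Rightarrow> real) \<Rightarrow> real \<Rightarrow> nat \<Rightarrow> nat list" where
  "genus_label E T i = (THE u. u \<in> present_genera E T \<and>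
      card {v \<in> present_genera E T. planar_before v u} = i)"

definition genus_age :: "(nat list \<Rightarrow> nat \<Rightarrow> real) \<Rightarrow> real \<Rightarrow> nat \<Rightarrow> real" where
  "genus_age E T i = T - genus_birth E (genus_label E T i)"

text \<open>Species count at age a of a Yule process (rate s, started at 1) with holding times H u k
in state k+1.\<close>
definition yule_size :: "(nat list \<Rightarrow> nat \<Rightarrow> real) \<Rightarrow> nat list \<Rightarrow> real \<Rightarrow> nat" where
  "yule_size H u a = Suc (card {k. (\<Sum>j\<le>k. H u j) \<le> a})"

definition genus_size ::
  "(nat list \<Rightarrow> nat \<Rightarrow> real) \<Rightarrow> (nat list \<Rightarrow> nat \<Rightarrow> real) \<Rightarrow> real \<Rightarrow> nat \<Rightarrow> nat" where
  "genus_size E H T i = yule_size H (genus_label E T i) (genus_age E T i)"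

definition AS_law :: "real \<Rightarrow> real \<Rightarrow> (real \<times> nat) measure" where
  "AS_law g s = density (lborel \<Otimes>\<^sub>M count_space UNIV)
     (\<lambda>(a, k). ennreal (if 0 < a \<and> 1 \<le> k
        then g * exp (- (g + s) * a) * (1 - exp (- s * a)) ^ (k - 1) else 0))"

abbreviation pair_space :: "(real \<times> nat) measure" where
  "pair_space \<equiv> borel \<Otimes>\<^sub>M count_space UNIV"

end

theory Submission
  imports Defs
begin

text \<open>
  Split the process at the birth time \<open>e\<close> of the first daughter of the primordial genus. From then on
  mother and daughter found independent copies of the process with remaining time \<open>a = T - e\<close>, and in
  planar order the derived genera are those of the mother born after \<open>e\<close>, then the first daughter, of
  age \<open>a\<close>, then the genera derived from it. The first daughter is thus the oldest entry of the list.

  Let \<open>\<alpha> t B\<close> be the probability that \<open>(A, S) \<in> B\<close> and \<open>A \<le> t\<close>. By induction on \<open>n\<close>, the probability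
  that there are \<open>n\<close> derived genera with values in \<open>B 0, \<dots>, B (n - 1)\<close> is
  \<open>exp (- g * T) * (\<Prod>i<n. \<alpha> T (B i))\<close>: the split contributes the factor
  \<open>g * exp (- g * (T - a)) * exp (- g * a) * exp (- g * a)\<close>, so what has to be integrated over
  \<open>0 \<le> a \<le> T\<close> is \<open>exp (- g * T)\<close> times the derivative of \<open>\<Prod>i<n. \<alpha> a (B i)\<close>, the term of the product
  rule that differentiates the \<open>j\<close>-th factor being the case where the first daughter has index \<open>j\<close>.
  These numbers are also the ones for the killed i.i.d. sequence, and they sum to one over \<open>n\<close>, which
  shows that almost surely only finitely many genera are present.
\<close>

section \<open>Planar order and the split at the first daughter\<close>

type_synonym clock = "(nat list \<times> nat) + (nat list \<times> nat)"

lemma planar_before_Nil_left [simp]: "planar_before [] v \<longleftrightarrow> v \<noteq> []"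
  by (auto simp: planar_before_def)

lemma planar_before_Nil_right [simp]: "\<not> planar_before u []"
  by (auto simp: planar_before_def)

lemma planar_before_Cons [simp]:
  "planar_before (a # u) (b # v) \<longleftrightarrow> b < a \<or> (a = b \<and> planar_before u v)"
proof
  assume "planar_before (a # u) (b # v)"
  then consider (1) w where "w \<noteq> []" "b # v = (a # u) @ w"
    | (2) w c d x y where "a # u = w @ c # x" "b # v = w @ d # y" "d < c"
    unfolding planar_before_def by blast
  then show "b < a \<or> (a = b \<and> planar_before u v)"
  proof cases
    case 1
    then show ?thesis unfolding planar_before_def by auto
  next
    case 2
    then show ?thesis unfolding planar_before_def by (cases w) auto
  qed
next
  assume "b < a \<or> (a = b \<and> planar_before u v)"
  then consider (1) "b < a" | (2) w where "a = b" "w \<noteq> []" "v = u @ w"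
    | (3) w c d x y where "a = b" "u = w @ c # x" "v = w @ d # y" "d < c"
    unfolding planar_before_def by blast
  then show "planar_before (a # u) (b # v)"
  proof cases
    case 1
    then show ?thesis unfolding planar_before_def by (metis append_Nil)
  next
    case (2 w)
    then show ?thesis unfolding planar_before_def by auto
  next
    case (3 w c d x y)
    then show ?thesis unfolding planar_before_def by (metis append_Cons)
  qed
qed

lemma planar_before_irrefl: "\<not> planar_before u u"
  by (induction u) auto

lemma planar_before_trans: "planar_before u v \<Longrightarrow> planar_before v w \<Longrightarrow> planar_before u w"
proof (induction u arbitrary: v w)
  case Nil
  then show ?case by (cases w) auto
next
  case (Cons a u)
  then show ?case by (cases v; cases w) auto
qed

lemma planar_before_total: "u \<noteq> v \<Longrightarrow> planar_before u v \<or> planar_before v u"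
proof (induction u arbitrary: v)
  case Nil
  then show ?case by (cases v) auto
next
  case (Cons a u)
  then show ?case by (cases v) auto
qed

lemma linorder_planar: "class.linorder (\<lambda>u v. u = v \<or> planar_before u v) planar_before"
  by unfold_locales (use planar_before_irrefl planar_before_trans planar_before_total in blast)+

definition genus_clock :: "(clock \<Rightarrow> real) \<Rightarrow> nat list \<Rightarrow> nat \<Rightarrow> real" where
  "genus_clock x p m = x (Inl (p, m))"

definition species_clock :: "(clock \<Rightarrow> real) \<Rightarrow> nat list \<Rightarrow> nat \<Rightarrow> real" where
  "species_clock x u k = x (Inr (u, k))"

fun mother_word :: "nat list \<Rightarrow> nat list" where
  "mother_word [] = []"
| "mother_word (n # v) = Suc n # v"

fun mother_clock :: "clock \<Rightarrow> clock" where
  "mother_clock (Inl (p, m)) = Inl (mother_word p, if p = [] then Suc m else m)"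
| "mother_clock (Inr (u, k)) = Inr (mother_word u, k)"

fun daughter_clock :: "clock \<Rightarrow> clock" where
  "daughter_clock (Inl (p, m)) = Inl (0 # p, m)"
| "daughter_clock (Inr (u, k)) = Inr (0 # u, k)"

abbreviation first_clock :: clock where "first_clock \<equiv> Inl ([], 0)"

lemma mother_word_eq_Nil_iff [simp]: "mother_word u = [] \<longleftrightarrow> u = []"
  by (cases u) auto

lemma inj_mother_word: "inj mother_word"
  by (rule injI, elim mother_word.elims) auto

lemma mother_word_eq_iff [simp]: "mother_word u = mother_word v \<longleftrightarrow> u = v"
  using inj_mother_word by (auto dest: injD)

lemma word_cases: "(\<exists>v. u = mother_word v) \<or> (\<exists>v. u = 0 # v)"
proof (cases u)
  case Nil
  then have "u = mother_word []" by simp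
  then show ?thesis by blast
next
  case (Cons n v)
  show ?thesis
  proof (cases n)
    case (Suc k)
    then have "u = mother_word (k # v)" using Cons by simp
    then show ?thesis by blast
  qed (use Cons in blast)
qed

lemma inj_mother_clock: "inj mother_clock"
  by (rule injI, elim mother_clock.elims) (auto split: if_splits)

lemma inj_daughter_clock: "inj daughter_clock"
  by (rule injI, elim daughter_clock.elims) auto

lemma planar_before_mother_word [simp]:
  "planar_before (mother_word u) (mother_word v) \<longleftrightarrow> planar_before u v"
  by (cases u; cases v) auto

lemma planar_before_mother_daughter [simp]: "planar_before (mother_word u) (0 # v)"
  by (cases u) auto

lemma birth_from_cong:
  "(\<And>v m. E (p @ v) m = E' (q @ v) m) \<Longrightarrow> birth_from E p u = birth_from E' q u"
proof (induction u arbitrary: p q)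
  case (Cons n u)
  have "birth_from E (p @ [n]) u = birth_from E' (q @ [n]) u"
    using Cons.prems by (intro Cons.IH) simp
  moreover have "E p m = E' q m" for m
    using Cons.prems[of "[]"] by simp
  ultimately show ?case by simp
qed simp

lemma genus_birth_Nil [simp]: "genus_birth E [] = 0"
  by (simp add: genus_birth_def)

lemma genus_birth_daughter:
  "genus_birth (genus_clock x) (0 # v) =
    x first_clock + genus_birth (genus_clock (x \<circ> daughter_clock)) v"
proof -
  have "birth_from (genus_clock x) [0] v = birth_from (genus_clock (x \<circ> daughter_clock)) [] v"
    by (rule birth_from_cong) (simp add: genus_clock_def)
  then show ?thesis by (simp add: genus_birth_def genus_clock_def)
qed

lemma genus_birth_mother:
  assumes "u \<noteq> []"
  shows "genus_birth (genus_clock x) (mother_word u) =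
    x first_clock + genus_birth (genus_clock (x \<circ> mother_clock)) u"
proof -
  obtain n v where u: "u = n # v" using assms by (cases u) auto
  have "birth_from (genus_clock x) [Suc n] v = birth_from (genus_clock (x \<circ> mother_clock)) [n] v"
    by (rule birth_from_cong) (simp add: genus_clock_def)
  moreover have "(\<Sum>m\<le>Suc n. x (Inl ([], m))) = x first_clock + (\<Sum>m\<le>n. x (Inl ([], Suc m)))"
    by (subst sum.atMost_Suc_shift) simp
  ultimately show ?thesis by (simp add: genus_birth_def genus_clock_def u)
qed

lemma birth_from_nonneg: "(\<And>p m. 0 < E p m) \<Longrightarrow> 0 \<le> birth_from E p u"
proof (induction u arbitrary: p)
  case (Cons n u)
  have "0 \<le> (\<Sum>m\<le>n. E p m)" using Cons.prems by (intro sum_nonneg less_imp_le)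
  then show ?case using Cons.IH[OF Cons.prems] by simp
qed simp

lemma genus_birth_ge_first:
  assumes "\<And>p m. 0 < E p m" "u \<noteq> []"
  shows "E [] 0 \<le> genus_birth E u"
proof -
  obtain n v where u: "u = n # v" using assms by (cases u) auto
  have "E [] 0 \<le> (\<Sum>m\<le>n. E [] m)"
    by (rule member_le_sum) (auto intro: less_imp_le assms)
  then show ?thesis
    using birth_from_nonneg[of E "[n]" v, OF assms(1)] by (simp add: u genus_birth_def)
qed

lemma present_genera_before_first:
  assumes "\<And>p m. 0 < E p m" "0 \<le> T" "T < E [] 0"
  shows "present_genera E T = {[]}"
  using genus_birth_ge_first[of E, OF assms(1)] assms(2,3)
  by (fastforce simp: present_genera_def)

lemma present_genera_split:
  fixes x :: "clock \<Rightarrow> real"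
  assumes "x first_clock \<le> T" "0 \<le> T"
  shows "present_genera (genus_clock x) T =
    mother_word ` present_genera (genus_clock (x \<circ> mother_clock)) (T - x first_clock) \<union>
    (#) 0 ` present_genera (genus_clock (x \<circ> daughter_clock)) (T - x first_clock)" (is "?L = ?R")
proof -
  have m: "mother_word v \<in> ?L \<longleftrightarrow>
      v \<in> present_genera (genus_clock (x \<circ> mother_clock)) (T - x first_clock)" for v
  proof (cases "v = []")
    case False
    then show ?thesis by (auto simp: present_genera_def genus_birth_mother)
  qed (use assms in \<open>simp add: present_genera_def\<close>)
  have d: "0 # v \<in> ?L \<longleftrightarrow>
      v \<in> present_genera (genus_clock (x \<circ> daughter_clock)) (T - x first_clock)" for v
    by (auto simp: present_genera_def genus_birth_daughter)
  show ?thesis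
  proof (intro set_eqI iffI)
    fix u assume "u \<in> ?L"
    then show "u \<in> ?R" using word_cases[of u] m d by blast
  qed (use m d in auto)
qed

definition genus_value :: "(clock \<Rightarrow> real) \<Rightarrow> real \<Rightarrow> nat list \<Rightarrow> real \<times> nat" where
  "genus_value x T u = (T - genus_birth (genus_clock x) u,
     yule_size (species_clock x) u (T - genus_birth (genus_clock x) u))"

lemma yule_size_mother:
  "yule_size (species_clock (x \<circ> mother_clock)) u = yule_size (species_clock x) (mother_word u)"
  by (simp add: yule_size_def species_clock_def fun_eq_iff)

lemma yule_size_daughter:
  "yule_size (species_clock (x \<circ> daughter_clock)) u = yule_size (species_clock x) (0 # u)"
  by (simp add: yule_size_def species_clock_def fun_eq_iff)

lemma genus_value_mother:
  "u \<noteq> [] \<Longrightarrow> genus_value x T (mother_word u) = genus_value (x \<circ> mother_clock) (T - x first_clock) u"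
  by (simp add: genus_value_def genus_birth_mother yule_size_mother algebra_simps)

lemma genus_value_daughter:
  "genus_value x T (0 # u) = genus_value (x \<circ> daughter_clock) (T - x first_clock) u"
  by (simp add: genus_value_def genus_birth_daughter yule_size_daughter algebra_simps)

text \<open>In planar order the derived genera are those of the mother after the first branching time,
  then the first daughter, then the genera derived from that daughter.\<close>
fun planar_event ::
  "nat \<Rightarrow> real \<Rightarrow> (clock \<Rightarrow> real) \<Rightarrow> (nat \<Rightarrow> (real \<times> nat) set) \<Rightarrow> bool" where
  "planar_event 0 T x B \<longleftrightarrow> T < x first_clock"
| "planar_event (Suc n) T x B \<longleftrightarrow> x first_clock \<le> T \<and>
     (\<exists>j\<in>{..n}. planar_event j (T - x first_clock) (x \<circ> mother_clock) B \<and>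
        (T - x first_clock, yule_size (species_clock x) [0] (T - x first_clock)) \<in> B j \<and>
        planar_event (n - j) (T - x first_clock) (x \<circ> daughter_clock) (\<lambda>i. B (Suc (i + j))))"

definition planar_list :: "(nat list \<Rightarrow> nat \<Rightarrow> real) \<Rightarrow> real \<Rightarrow> nat list list \<Rightarrow> bool" where
  "planar_list E T us \<longleftrightarrow> sorted_wrt planar_before us \<and> set us = present_genera E T"

lemma planar_list_unique: "planar_list E T us \<Longrightarrow> planar_list E T vs \<Longrightarrow> us = vs"
  unfolding planar_list_def by (metis linorder.strict_sorted_equal[OF linorder_planar])

lemma planar_list_exists: "finite (present_genera E T) \<Longrightarrow> \<exists>us. planar_list E T us"
  unfolding planar_list_def
  by (metis linorder.finite_set_strict_sorted[OF linorder_planar])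

lemma planar_list_distinct: "planar_list E T us \<Longrightarrow> distinct us"
  unfolding planar_list_def by (metis linorder.strict_sorted_iff[OF linorder_planar])

lemma num_genera_planar_list: "planar_list E T us \<Longrightarrow> num_genera E T = length us"
  using planar_list_distinct[of E T us]
  by (simp add: num_genera_def planar_list_def flip: distinct_card)

lemma genus_label_unique:
  assumes "u \<in> present_genera E T" "card {v \<in> present_genera E T. planar_before v u} = Suc i"
    and "w \<in> present_genera E T" "card {v \<in> present_genera E T. planar_before v w} = Suc i"
  shows "u = w"
proof -
  have *: False if uw: "planar_before u w" "u \<in> present_genera E T"
      "card {v \<in> present_genera E T. planar_before v w} = Suc i"
      "card {v \<in> present_genera E T. planar_before v u} = Suc i" for u w
  proof -
    have "finite {v \<in> present_genera E T. planar_before v w}"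
      using that by (intro card_ge_0_finite) simp
    moreover have "{v \<in> present_genera E T. planar_before v u} \<subset>
        {v \<in> present_genera E T. planar_before v w}"
      using uw planar_before_irrefl planar_before_trans by blast
    ultimately have "card {v \<in> present_genera E T. planar_before v u} <
        card {v \<in> present_genera E T. planar_before v w}"
      by (rule psubset_card_mono)
    with that show False by simp
  qed
  show ?thesis
  proof (rule ccontr)
    assume "u \<noteq> w"
    then consider "planar_before u w" | "planar_before w u" using planar_before_total by blast
    then show False by cases (use *[of u w] *[of w u] assms in auto)
  qed
qed

lemma genus_label_planar_list:
  assumes us: "planar_list E T us" and i: "Suc i < length us"
  shows "genus_label E T (Suc i) = us ! Suc i"
proof -
  have sorted: "planar_before (us ! k) (us ! l)" if "k < l" "l < length us" for k l
    using us that by (auto simp: planar_list_def sorted_wrt_iff_nth_less)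
  have "{v \<in> present_genera E T. planar_before v (us ! Suc i)} = (!) us ` {..<Suc i}"
  proof (intro set_eqI iffI)
    fix v assume "v \<in> {v \<in> present_genera E T. planar_before v (us ! Suc i)}"
    then have v: "v \<in> set us" "planar_before v (us ! Suc i)"
      using us by (auto simp: planar_list_def)
    then obtain k where k: "k < length us" "v = us ! k" by (auto simp: in_set_conv_nth)
    have "k < Suc i"
    proof (rule ccontr)
      assume "\<not> k < Suc i"
      then have "k = Suc i \<or> planar_before (us ! Suc i) v" using k sorted[of "Suc i" k] by (metis linorder_neqE_nat)
      then show False using v(2) k(2) planar_before_irrefl planar_before_trans by blast
    qed
    then show "v \<in> (!) us ` {..<Suc i}" using k by auto
  next
    fix v assume "v \<in> (!) us ` {..<Suc i}"
    then show "v \<in> {v \<in> present_genera E T. planar_before v (us ! Suc i)}"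
      using sorted i us by (auto simp: planar_list_def)
  qed
  moreover have "inj_on ((!) us) {..<Suc i}"
    using planar_list_distinct[OF us] i by (auto intro!: inj_on_nth)
  ultimately have "card {v \<in> present_genera E T. planar_before v (us ! Suc i)} = Suc i"
    by (metis card_image card_lessThan)
  moreover have "us ! Suc i \<in> present_genera E T"
    using us nth_mem[OF i] by (simp add: planar_list_def)
  ultimately show ?thesis
    unfolding genus_label_def by (intro the_equality) (auto intro: genus_label_unique)
qed

lemma planar_list_nth_0:
  assumes us: "planar_list E T us" and T: "0 \<le> T"
  shows "us \<noteq> []" "us ! 0 = []"
proof -
  have "[] \<in> set us" using us T by (simp add: planar_list_def present_genera_def)
  then obtain k where k: "k < length us" "us ! k = []" by (auto simp: in_set_conv_nth)
  then show "us \<noteq> []" by auto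
  have "k = 0"
    using us k unfolding planar_list_def sorted_wrt_iff_nth_less
    by (metis gr0I planar_before_Nil_right)
  then show "us ! 0 = []" using k by simp
qed

lemma planar_list_split:
  fixes x :: "clock \<Rightarrow> real"
  assumes T: "x first_clock \<le> T" "0 \<le> T"
    and us: "planar_list (genus_clock (x \<circ> mother_clock)) (T - x first_clock) us"
    and vs: "planar_list (genus_clock (x \<circ> daughter_clock)) (T - x first_clock) vs"
  shows "planar_list (genus_clock x) T (map mother_word us @ map ((#) 0) vs)"
  using us vs present_genera_split[of x T, OF T]
  by (auto simp: planar_list_def sorted_wrt_append sorted_wrt_map)

lemma all_less_Suc_add: "(\<forall>i<Suc n. P i) \<longleftrightarrow> (\<forall>i<j. P i) \<and> P j \<and> (\<forall>i<n - j. P (Suc (i + j)))"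
  if "j \<le> n" for P :: "nat \<Rightarrow> bool"
proof (intro iffI conjI allI impI)
  fix i assume *: "(\<forall>i<j. P i) \<and> P j \<and> (\<forall>i<n - j. P (Suc (i + j)))" and i: "i < Suc n"
  consider "i < j" | "i = j" | "j < i" by linarith
  then show "P i"
  proof cases
    case 3
    then have "P (Suc ((i - Suc j) + j))" using * i by (intro *[THEN conjunct2, THEN conjunct2, rule_format]) linarith
    then show ?thesis using 3 by simp
  qed (use * in auto)
qed (use that in auto)

lemma planar_event_iff_planar_list:
  assumes "\<And>p m. 0 < genus_clock x p m" "0 \<le> T"
  shows "planar_event n T x B \<longleftrightarrow> (\<exists>us. planar_list (genus_clock x) T us \<and> length us = Suc n \<and>
     (\<forall>i<n. genus_value x T (us ! Suc i) \<in> B i))"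
  using assms
proof (induction n arbitrary: T x B rule: less_induct)
  case (less n)
  note pos = less.prems(1) and T = less.prems(2)
  let ?e = "x first_clock" and ?xm = "x \<circ> mother_clock" and ?xd = "x \<circ> daughter_clock"
  have posm: "0 < genus_clock ?xm p m" for p m
    using pos[of "mother_word p"] by (simp add: genus_clock_def)
  have posd: "0 < genus_clock ?xd p m" for p m
    using pos[of "0 # p"] by (simp add: genus_clock_def)
  show ?case
  proof (cases "T < ?e")
    case True
    have "present_genera (genus_clock x) T = {[]}"
      using pos T True by (intro present_genera_before_first) (auto simp: genus_clock_def)
    then have pl: "planar_list (genus_clock x) T [[]]" by (simp add: planar_list_def)
    then have "planar_list (genus_clock x) T us \<longleftrightarrow> us = [[]]" for us
      using planar_list_unique by blast
    then show ?thesis using True by (cases n) auto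
  next
    case False
    then have e: "?e \<le> T" by simp
    show ?thesis
    proof (cases n)
      case 0
      have "length us \<noteq> 1" if us: "planar_list (genus_clock x) T us" for us
      proof
        assume "length us = 1"
        then obtain u where "us = [u]" by (auto simp: length_Suc_conv)
        moreover have "[] \<in> set us" "[0] \<in> set us"
          using us e T genus_birth_daughter[of x "[]"] by (auto simp: planar_list_def present_genera_def)
        ultimately show False by auto
      qed
      then show ?thesis using False 0 by auto
    next
      case (Suc k)
      have val: "(\<forall>i<n. genus_value x T ((map mother_word us @ map ((#) 0) vs) ! Suc i) \<in> B i) \<longleftrightarrow>
          (\<forall>i<j. genus_value ?xm (T - ?e) (us ! Suc i) \<in> B i) \<and>
          (T - ?e, yule_size (species_clock x) [0] (T - ?e)) \<in> B j \<and>
          (\<forall>i<k - j. genus_value ?xd (T - ?e) (vs ! Suc i) \<in> B (Suc (i + j)))"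
        if us: "planar_list (genus_clock ?xm) (T - ?e) us" and vs: "planar_list (genus_clock ?xd) (T - ?e) vs"
          and len: "length us = Suc j" "length vs = Suc (k - j)" "j \<le> k" for us vs j
      proof -
        let ?L = "map mother_word us @ map ((#) 0) vs"
        have "us ! Suc i \<noteq> []" if "i < j" for i
          using us len that unfolding planar_list_def sorted_wrt_iff_nth_less
          by (metis Suc_less_eq planar_before_Nil_right zero_less_Suc)
        then have "\<forall>i<j. genus_value x T (?L ! Suc i) = genus_value ?xm (T - ?e) (us ! Suc i)"
          using len by (auto simp: nth_append genus_value_mother)
        moreover have "?L ! Suc j = [0]"
          using len planar_list_nth_0[OF vs] e by (simp add: nth_append)
        then have "genus_value x T (?L ! Suc j) = (T - ?e, yule_size (species_clock x) [0] (T - ?e))"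
          by (simp add: genus_value_daughter) (simp add: genus_value_def yule_size_daughter)
        moreover have "\<forall>i<k - j. genus_value x T (?L ! Suc (Suc (i + j))) =
            genus_value ?xd (T - ?e) (vs ! Suc i)"
          using len by (auto simp: nth_append genus_value_daughter)
        ultimately show ?thesis
          unfolding Suc all_less_Suc_add[OF len(3)] by auto
      qed
      have "planar_event n T x B \<longleftrightarrow> (\<exists>j\<le>k. planar_event j (T - ?e) ?xm B \<and>
          (T - ?e, yule_size (species_clock x) [0] (T - ?e)) \<in> B j \<and>
          planar_event (k - j) (T - ?e) ?xd (\<lambda>i. B (Suc (i + j))))"
        using e by (auto simp: Suc Bex_def)
      also have "\<dots> \<longleftrightarrow> (\<exists>j\<le>k. \<exists>us vs. planar_list (genus_clock ?xm) (T - ?e) us \<and>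
          planar_list (genus_clock ?xd) (T - ?e) vs \<and> length us = Suc j \<and> length vs = Suc (k - j) \<and>
          (\<forall>i<j. genus_value ?xm (T - ?e) (us ! Suc i) \<in> B i) \<and>
          (T - ?e, yule_size (species_clock x) [0] (T - ?e)) \<in> B j \<and>
          (\<forall>i<k - j. genus_value ?xd (T - ?e) (vs ! Suc i) \<in> B (Suc (i + j))))"
      proof (intro ex_cong1 conj_cong refl)
        fix j assume "j \<le> k"
        then have j: "j < n" "k - j < n" using Suc by auto
        show "(planar_event j (T - ?e) ?xm B \<and>
          (T - ?e, yule_size (species_clock x) [0] (T - ?e)) \<in> B j \<and>
          planar_event (k - j) (T - ?e) ?xd (\<lambda>i. B (Suc (i + j)))) \<longleftrightarrow> (\<exists>us vs. planar_list (genus_clock ?xm) (T - ?e) us \<and>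
          planar_list (genus_clock ?xd) (T - ?e) vs \<and> length us = Suc j \<and> length vs = Suc (k - j) \<and>
          (\<forall>i<j. genus_value ?xm (T - ?e) (us ! Suc i) \<in> B i) \<and>
          (T - ?e, yule_size (species_clock x) [0] (T - ?e)) \<in> B j \<and>
          (\<forall>i<k - j. genus_value ?xd (T - ?e) (vs ! Suc i) \<in> B (Suc (i + j))))"
          unfolding less.IH[OF j(1) posm, of "T - ?e", simplified e diff_ge_0_iff_ge, OF TrueI]
            less.IH[OF j(2) posd, of "T - ?e", simplified e diff_ge_0_iff_ge, OF TrueI]
          by blast
      qed
      also have "\<dots> \<longleftrightarrow> (\<exists>ws. planar_list (genus_clock x) T ws \<and> length ws = Suc n \<and>
         (\<forall>i<n. genus_value x T (ws ! Suc i) \<in> B i))"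
      proof (intro iffI; elim exE conjE)
        fix j us vs
        assume *: "j \<le> k" "planar_list (genus_clock ?xm) (T - ?e) us"
          "planar_list (genus_clock ?xd) (T - ?e) vs" "length us = Suc j" "length vs = Suc (k - j)"
          "\<forall>i<j. genus_value ?xm (T - ?e) (us ! Suc i) \<in> B i"
          "(T - ?e, yule_size (species_clock x) [0] (T - ?e)) \<in> B j"
          "\<forall>i<k - j. genus_value ?xd (T - ?e) (vs ! Suc i) \<in> B (Suc (i + j))"
        let ?L = "map mother_word us @ map ((#) 0) vs"
        have "planar_list (genus_clock x) T ?L" using * e T by (intro planar_list_split)
        moreover have "length ?L = Suc n" using * Suc by simp
        moreover have "\<forall>i<n. genus_value x T (?L ! Suc i) \<in> B i" using * by (subst val) auto
        ultimately show "\<exists>ws. planar_list (genus_clock x) T ws \<and> length ws = Suc n \<and>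
         (\<forall>i<n. genus_value x T (ws ! Suc i) \<in> B i)" by blast
      next
        fix ws assume ws: "planar_list (genus_clock x) T ws" "length ws = Suc n"
          "\<forall>i<n. genus_value x T (ws ! Suc i) \<in> B i"
        have fin: "finite (present_genera (genus_clock x) T)"
          using ws(1) unfolding planar_list_def by (metis List.finite_set)
        have "finite (present_genera (genus_clock ?xm) (T - ?e))"
          "finite (present_genera (genus_clock ?xd) (T - ?e))"
          using fin unfolding present_genera_split[of x T, OF e T]
          by (auto dest!: finite_imageD intro: inj_on_subset[OF inj_mother_word])
        then obtain us vs where us: "planar_list (genus_clock ?xm) (T - ?e) us"
          and vs: "planar_list (genus_clock ?xd) (T - ?e) vs"
          using planar_list_exists by metis
        have eq: "ws = map mother_word us @ map ((#) 0) vs"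
          using planar_list_unique[OF ws(1)] planar_list_split[of x T us vs, OF e T us vs] by blast
        have ne: "us \<noteq> []" "vs \<noteq> []" using planar_list_nth_0[OF us] planar_list_nth_0[OF vs] e by auto
        define j where "j = length us - 1"
        have j: "length us = Suc j" "length vs = Suc (k - j)" "j \<le> k"
          using ne ws(2) unfolding eq j_def Suc by (cases us; cases vs; simp)+
        show "\<exists>j\<le>k. \<exists>us vs. planar_list (genus_clock ?xm) (T - ?e) us \<and>
          planar_list (genus_clock ?xd) (T - ?e) vs \<and> length us = Suc j \<and> length vs = Suc (k - j) \<and>
          (\<forall>i<j. genus_value ?xm (T - ?e) (us ! Suc i) \<in> B i) \<and>
          (T - ?e, yule_size (species_clock x) [0] (T - ?e)) \<in> B j \<and>
          (\<forall>i<k - j. genus_value ?xd (T - ?e) (vs ! Suc i) \<in> B (Suc (i + j)))"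
          using ws(3) us vs j unfolding eq val[OF us vs j] by blast
      qed
      finally show ?thesis .
    qed
  qed
qed

lemma planar_event_iff:
  assumes "\<And>p m. 0 < genus_clock x p m" "0 \<le> T"
  shows "planar_event n T x B \<longleftrightarrow> num_genera (genus_clock x) T = Suc n \<and>
    (\<forall>i<n. (genus_age (genus_clock x) T (Suc i),
      genus_size (genus_clock x) (species_clock x) T (Suc i)) \<in> B i)"
proof -
  have val: "(genus_age (genus_clock x) T (Suc i),
      genus_size (genus_clock x) (species_clock x) T (Suc i)) = genus_value x T (us ! Suc i)"
    if "planar_list (genus_clock x) T us" "length us = Suc n" "i < n" for us i
    using genus_label_planar_list[OF that(1), of i] that
    by (simp add: genus_size_def genus_age_def genus_value_def)
  have "\<exists>us. planar_list (genus_clock x) T us" if "num_genera (genus_clock x) T = Suc n"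
    using that by (intro planar_list_exists card_ge_0_finite) (simp add: num_genera_def)
  then obtain us where us: "planar_list (genus_clock x) T us" if "num_genera (genus_clock x) T = Suc n"
    by blast
  show ?thesis
    unfolding planar_event_iff_planar_list[OF assms]
  proof (intro iffI; elim exE conjE)
    fix us
    assume *: "planar_list (genus_clock x) T us" "length us = Suc n"
      "\<forall>i<n. genus_value x T (us ! Suc i) \<in> B i"
    then show "num_genera (genus_clock x) T = Suc n \<and>
      (\<forall>i<n. (genus_age (genus_clock x) T (Suc i),
        genus_size (genus_clock x) (species_clock x) T (Suc i)) \<in> B i)"
      using num_genera_planar_list[OF *(1)] val[OF *(1,2)] by simp
  next
    assume n: "num_genera (genus_clock x) T = Suc n"
      and *: "\<forall>i<n. (genus_age (genus_clock x) T (Suc i),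
        genus_size (genus_clock x) (species_clock x) T (Suc i)) \<in> B i"
    have "length us = Suc n" using num_genera_planar_list[OF us[OF n]] n by simp
    with us[OF n] val[OF us[OF n] this] * show "\<exists>us. planar_list (genus_clock x) T us \<and>
      length us = Suc n \<and> (\<forall>i<n. genus_value x T (us ! Suc i) \<in> B i)" by auto
  qed
qed

section \<open>Measurability and independence\<close>

lemma measurable_yule_size [measurable (raw)]:
  assumes [measurable]: "\<And>i. (\<lambda>w. x w i) \<in> borel_measurable N" "a \<in> borel_measurable N"
  shows "(\<lambda>w. yule_size (species_clock (x w)) u (a w)) \<in> measurable N (count_space UNIV)"
  unfolding yule_size_def species_clock_def by measurable

lemma pred_planar_event:
  assumes "\<And>i. (\<lambda>w. x w i) \<in> borel_measurable N" "t \<in> borel_measurable N"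
    and "\<And>i. B i \<in> sets pair_space"
  shows "Measurable.pred N (\<lambda>w. planar_event n (t w) (x w) B)"
  using assms
proof (induction n arbitrary: t x B rule: less_induct)
  case (less n)
  note [measurable] = less.prems
  show ?case
  proof (cases n)
    case 0
    then show ?thesis by simp
  next
    case (Suc k)
    have [measurable]: "Measurable.pred N (\<lambda>w. planar_event j (t w - x w first_clock) (x w \<circ> r) B')"
      if "j \<le> k" "\<And>i. B' i \<in> sets pair_space" for j r B'
      using that Suc by (intro less.IH) auto
    have "Measurable.pred N (\<lambda>w. x w first_clock \<le> t w \<and>
     (\<exists>j\<in>{..k}. planar_event j (t w - x w first_clock) (x w \<circ> mother_clock) B \<and>
        (t w - x w first_clock, yule_size (species_clock (x w)) [0] (t w - x w first_clock)) \<in> B j \<and>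
        planar_event (k - j) (t w - x w first_clock) (x w \<circ> daughter_clock) (\<lambda>i. B (Suc (i + j)))))"
      by (intro pred_intros_logic pred_intros_finite finite_atMost) auto
    then show ?thesis by (simp add: Suc)
  qed
qed

lemma planar_event_unique:
  "planar_event n T x B \<Longrightarrow> planar_event n' T x B' \<Longrightarrow> n = n'"
proof (induction n arbitrary: n' T x B B' rule: less_induct)
  case (less n)
  show ?case
  proof (cases n)
    case 0
    then show ?thesis using less.prems by (cases n') auto
  next
    case (Suc k)
    then obtain k' where n': "n' = Suc k'" using less.prems by (cases n') auto
    let ?T = "T - x first_clock"
    obtain j where j: "j \<le> k" "planar_event j ?T (x \<circ> mother_clock) B"
      "planar_event (k - j) ?T (x \<circ> daughter_clock) (\<lambda>i. B (Suc (i + j)))"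
      using less.prems(1) by (auto simp: Suc)
    obtain j' where j': "j' \<le> k'" "planar_event j' ?T (x \<circ> mother_clock) B'"
      "planar_event (k' - j') ?T (x \<circ> daughter_clock) (\<lambda>i. B' (Suc (i + j')))"
      using less.prems(2) by (auto simp: n')
    have "j = j'" by (rule less.IH[OF _ j(2) j'(2)]) (use j Suc in simp)
    moreover have "k - j = k' - j'" by (rule less.IH[OF _ j(3) j'(3)]) (use j Suc in simp)
    ultimately show ?thesis using j j' Suc n' by simp
  qed
qed

lemma planar_event_cong:
  "(\<And>i. i \<notin> Inr ` ({[]} \<times> UNIV) \<Longrightarrow> x i = y i) \<Longrightarrow> planar_event n T x B \<longleftrightarrow> planar_event n T y B"
proof (induction n arbitrary: T x y B rule: less_induct)
  case (less n)
  have e: "x first_clock = y first_clock" by (rule less.prems) auto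
  have s: "species_clock x [0] = species_clock y [0]"
    unfolding species_clock_def by (rule ext, rule less.prems) auto
  have m: "(x \<circ> mother_clock) i = (y \<circ> mother_clock) i" if "i \<notin> Inr ` ({[]} \<times> UNIV)" for i
    unfolding comp_def by (rule less.prems) (use that in \<open>cases i rule: mother_clock.cases; auto\<close>)
  have d: "(x \<circ> daughter_clock) i = (y \<circ> daughter_clock) i" for i
    unfolding comp_def by (rule less.prems) (cases i rule: daughter_clock.cases; auto)
  show ?case
  proof (cases n)
    case 0
    then show ?thesis by (simp add: e)
  next
    case (Suc k)
    have "planar_event j T' (x \<circ> mother_clock) B' = planar_event j T' (y \<circ> mother_clock) B'"
      "planar_event j T' (x \<circ> daughter_clock) B' = planar_event j T' (y \<circ> daughter_clock) B'"
      if "j \<le> k" for j T' B'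
      using that Suc by (auto intro!: less.IH m d)
    then show ?thesis by (simp add: Suc e s yule_size_def)
  qed
qed

lemma (in prob_space) indep_vars_Fubini:
  fixes X :: "'i \<Rightarrow> 'a \<Rightarrow> real" and R :: "('i \<Rightarrow> real) \<Rightarrow> ('i \<Rightarrow> real) \<Rightarrow> bool"
  assumes ind: "indep_vars (\<lambda>_. borel) X UNIV" and IJ: "I \<inter> J = {}"
    and R: "Measurable.pred (Pi\<^sub>M UNIV (\<lambda>_. borel) \<Otimes>\<^sub>M Pi\<^sub>M UNIV (\<lambda>_. borel)) (\<lambda>(x, y). R x y)"
    and dep: "\<And>x y x' y'. (\<And>i. i \<in> I \<Longrightarrow> x i = x' i) \<Longrightarrow> (\<And>i. i \<in> J \<Longrightarrow> y i = y' i) \<Longrightarrow> R x y = R x' y'"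
  shows "emeasure M {\<omega> \<in> space M. R (\<lambda>i. X i \<omega>) (\<lambda>i. X i \<omega>)} =
    (\<integral>\<^sup>+\<omega>'. emeasure M {\<omega> \<in> space M. R (\<lambda>i. X i \<omega>') (\<lambda>i. X i \<omega>)} \<partial>M)"
proof -
  let ?P = "Pi\<^sub>M UNIV (\<lambda>_::'i. borel :: real measure)"
  let ?ext = "\<lambda>K (y::'i \<Rightarrow> real) i. if i \<in> K then y i else 0"
  let ?X = "\<lambda>K \<omega>. ?ext K (\<lambda>i. X i \<omega>)"
  have R': "Measurable.pred (?P \<Otimes>\<^sub>M ?P) (\<lambda>p. R (fst p) (snd p))"
    using R by (simp add: case_prod_beta')
  have ext: "?ext K \<in> measurable (Pi\<^sub>M K (\<lambda>_. borel)) ?P" for K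
  proof (rule measurable_PiM_single')
    fix i show "(\<lambda>y. ?ext K y i) \<in> measurable (Pi\<^sub>M K (\<lambda>_. borel)) borel"
      by (cases "i \<in> K") (auto intro: measurable_component_singleton)
  qed (auto simp: space_PiM)
  have "indep_var (Pi\<^sub>M I (\<lambda>_. borel)) (\<lambda>\<omega>. restrict (\<lambda>i. X i \<omega>) I)
      (Pi\<^sub>M J (\<lambda>_. borel)) (\<lambda>\<omega>. restrict (\<lambda>i. X i \<omega>) J)"
    using ind IJ by (intro indep_var_restrict) auto
  from indep_var_compose[OF this ext ext]
  have iv: "indep_var ?P (?X I) ?P (?X J)"
    by (simp add: comp_def restrict_def cong: if_cong)
  then have [measurable]: "?X I \<in> measurable M ?P" "?X J \<in> measurable M ?P"
    and dist: "distr M ?P (?X I) \<Otimes>\<^sub>M distr M ?P (?X J) = distr M (?P \<Otimes>\<^sub>M ?P) (\<lambda>\<omega>. (?X I \<omega>, ?X J \<omega>))"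
    unfolding indep_var_distribution_eq by auto
  let ?S = "{p \<in> space (?P \<Otimes>\<^sub>M ?P). R (fst p) (snd p)}"
  have S: "?S \<in> sets (?P \<Otimes>\<^sub>M ?P)" using R' by (simp add: pred_def)
  interpret J: prob_space "distr M ?P (?X J)" by (rule prob_space_distr) measurable
  have RX: "R (\<lambda>i. X i \<omega>') (\<lambda>i. X i \<omega>) = R (?X I \<omega>') (?X J \<omega>)" for \<omega>' \<omega>
    by (rule dep) auto
  have "emeasure M {\<omega> \<in> space M. R (\<lambda>i. X i \<omega>) (\<lambda>i. X i \<omega>)} =
      emeasure (distr M (?P \<Otimes>\<^sub>M ?P) (\<lambda>\<omega>. (?X I \<omega>, ?X J \<omega>))) ?S"
    using S by (subst emeasure_distr)
      (auto intro!: arg_cong[where f="emeasure M"] simp: RX space_pair_measure space_PiM)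
  also have "\<dots> = (\<integral>\<^sup>+x. emeasure (distr M ?P (?X J)) (Pair x -` ?S) \<partial>distr M ?P (?X I))"
    unfolding dist[symmetric] using S by (intro J.emeasure_pair_measure_alt) simp
  also have "\<dots> = (\<integral>\<^sup>+\<omega>'. emeasure (distr M ?P (?X J)) (Pair (?X I \<omega>') -` ?S) \<partial>M)"
    using S by (intro nn_integral_distr J.measurable_emeasure_Pair) (auto simp: cong: measurable_cong_sets)
  also have "\<dots> = (\<integral>\<^sup>+\<omega>'. emeasure M {\<omega> \<in> space M. R (\<lambda>i. X i \<omega>') (\<lambda>i. X i \<omega>)} \<partial>M)"
    using S sets_Pair1[OF S] by (intro nn_integral_cong, subst emeasure_distr)
      (auto intro!: arg_cong[where f="emeasure M"] simp: RX space_pair_measure space_PiM)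
  finally show ?thesis .
qed

lemma (in prob_space) indep_vars_disjoint_events:
  fixes X :: "'i \<Rightarrow> 'a \<Rightarrow> real" and P Q :: "('i \<Rightarrow> real) \<Rightarrow> bool"
  assumes ind: "indep_vars (\<lambda>_. borel) X UNIV" and IJ: "I \<inter> J = {}"
    and P [measurable]: "Measurable.pred (Pi\<^sub>M UNIV (\<lambda>_. borel)) P"
    and Q [measurable]: "Measurable.pred (Pi\<^sub>M UNIV (\<lambda>_. borel)) Q"
    and depP: "\<And>x x'. (\<And>i. i \<in> I \<Longrightarrow> x i = x' i) \<Longrightarrow> P x = P x'"
    and depQ: "\<And>x x'. (\<And>i. i \<in> J \<Longrightarrow> x i = x' i) \<Longrightarrow> Q x = Q x'"
  shows "emeasure M {\<omega> \<in> space M. P (\<lambda>i. X i \<omega>) \<and> Q (\<lambda>i. X i \<omega>)} =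
    emeasure M {\<omega> \<in> space M. P (\<lambda>i. X i \<omega>)} * emeasure M {\<omega> \<in> space M. Q (\<lambda>i. X i \<omega>)}"
proof -
  have X: "X i \<in> borel_measurable M" for i
    using ind by (simp add: indep_vars_def)
  have [measurable]: "(\<lambda>\<omega> i. X i \<omega>) \<in> measurable M (Pi\<^sub>M UNIV (\<lambda>_. borel))"
    by (rule measurable_PiM_single'[OF X]) simp
  have "emeasure M {\<omega> \<in> space M. P (\<lambda>i. X i \<omega>) \<and> Q (\<lambda>i. X i \<omega>)} =
    (\<integral>\<^sup>+\<omega>'. emeasure M {\<omega> \<in> space M. P (\<lambda>i. X i \<omega>') \<and> Q (\<lambda>i. X i \<omega>)} \<partial>M)"
  proof (rule indep_vars_Fubini[OF ind IJ, where R = "\<lambda>x y. P x \<and> Q y"])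
    show "Measurable.pred (Pi\<^sub>M UNIV (\<lambda>_. borel) \<Otimes>\<^sub>M Pi\<^sub>M UNIV (\<lambda>_. borel)) (\<lambda>(x, y). P x \<and> Q y)"
      by measurable
    show "(P x \<and> Q y) = (P x' \<and> Q y')" if "\<And>i. i \<in> I \<Longrightarrow> x i = x' i" "\<And>i. i \<in> J \<Longrightarrow> y i = y' i"
      for x y x' y'
      using depP[of x x', OF that(1)] depQ[of y y', OF that(2)] by simp
  qed
  also have "\<dots> = (\<integral>\<^sup>+\<omega>'. indicator {\<omega> \<in> space M. P (\<lambda>i. X i \<omega>)} \<omega>' *
      emeasure M {\<omega> \<in> space M. Q (\<lambda>i. X i \<omega>)} \<partial>M)"
    by (intro nn_integral_cong) (auto simp: indicator_def)
  also have "\<dots> = emeasure M {\<omega> \<in> space M. P (\<lambda>i. X i \<omega>)} * emeasure M {\<omega> \<in> space M. Q (\<lambda>i. X i \<omega>)}"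
    by (subst nn_integral_multc) auto
  finally show ?thesis .
qed

lemma (in prob_space) indep_vars_reindex:
  assumes ind: "indep_vars M' X I" and f: "inj_on f J" "f ` J \<subseteq> I"
  shows "indep_vars (\<lambda>j. M' (f j)) (\<lambda>j. X (f j)) J"
  unfolding indep_vars_def2
proof (intro conjI ballI)
  fix j assume "j \<in> J"
  then show "random_variable (M' (f j)) (X (f j))"
    using ind f by (auto simp: indep_vars_def2)
next
  have *: "indep_sets (\<lambda>i. {X i -` A \<inter> space M |A. A \<in> sets (M' i)}) I"
    using ind by (auto simp: indep_vars_def2)
  show "indep_sets (\<lambda>i. {X (f i) -` A \<inter> space M |A. A \<in> sets (M' (f i))}) J"
    unfolding indep_sets_def
  proof (intro conjI ballI allI impI)
    fix i assume "i \<in> J"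
    then show "{X (f i) -` A \<inter> space M |A. A \<in> sets (M' (f i))} \<subseteq> events"
      using * f unfolding indep_sets_def by auto
  next
    fix K A assume K: "K \<subseteq> J" "K \<noteq> {}" "finite K"
      and A: "A \<in> Pi K (\<lambda>i. {X (f i) -` A \<inter> space M |A. A \<in> sets (M' (f i))})"
    have inj: "inj_on f K" using f K by (blast intro: inj_on_subset)
    let ?A = "\<lambda>i. A (the_inv_into K f i)"
    have "prob (\<Inter>i\<in>f ` K. ?A i) = (\<Prod>i\<in>f ` K. prob (?A i))"
      using K f A inj by (intro indep_setsD[OF *]) (auto simp: the_inv_into_f_f)
    then show "prob (\<Inter>i\<in>K. A i) = (\<Prod>i\<in>K. prob (A i))"
      using inj by (simp add: prod.reindex the_inv_into_f_f)
  qed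
qed

section \<open>The species process\<close>

definition (in prob_space) yule_family :: "real \<Rightarrow> real \<Rightarrow> (clock \<Rightarrow> 'a \<Rightarrow> real) \<Rightarrow> bool" where
  "yule_family g s X \<longleftrightarrow> indep_vars (\<lambda>_. borel) X UNIV \<and>
     (\<forall>p m. distributed M lborel (X (Inl (p, m))) (exponential_density g)) \<and>
     (\<forall>u k. distributed M lborel (X (Inr (u, k))) (exponential_density (s * real (Suc k))))"

definition yule_prob :: "real \<Rightarrow> real \<Rightarrow> nat \<Rightarrow> real" where
  "yule_prob s a k = (if 1 \<le> k then exp (- s * a) * (1 - exp (- s * a)) ^ (k - 1) else 0)"

lemma yule_size_eq_iff:
  assumes pos: "\<And>k. 0 < H u k" and a: "0 \<le> a" and ex: "\<exists>m. a < (\<Sum>j<m. H u j)"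
  shows "yule_size H u a = Suc m \<longleftrightarrow> (\<Sum>j<m. H u j) \<le> a \<and> a < (\<Sum>j<Suc m. H u j)"
proof -
  let ?S = "\<lambda>m. \<Sum>j<m. H u j"
  have mono: "?S i \<le> ?S j" if "i \<le> j" for i j
    using that pos by (intro sum_mono2) (auto intro: less_imp_le)
  define m0 where "m0 = (LEAST m. a < ?S m)"
  have m0: "a < ?S m0" unfolding m0_def using ex by (rule LeastI_ex)
  then have "m0 \<noteq> 0" using a by (auto intro!: Nat.gr0I)
  then obtain p where p: "m0 = Suc p" by (cases m0) auto
  have le: "?S p \<le> a" using not_less_Least[of p "\<lambda>m. a < ?S m"] p m0_def by simp
  have "{k. (\<Sum>j\<le>k. H u j) \<le> a} = {..<p}"
  proof (intro set_eqI iffI)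
    fix k assume "k \<in> {k. (\<Sum>j\<le>k. H u j) \<le> a}"
    then have "?S (Suc k) \<le> a" by (simp add: lessThan_Suc_atMost)
    then show "k \<in> {..<p}" using m0 mono[of "Suc p" "Suc k"] p by (auto simp: not_less[symmetric])
  next
    fix k assume "k \<in> {..<p}"
    then show "k \<in> {k. (\<Sum>j\<le>k. H u j) \<le> a}"
      using mono[of "Suc k" p] le by (auto simp: lessThan_Suc_atMost)
  qed
  then have "yule_size H u a = Suc p" by (simp add: yule_size_def)
  moreover have "m = p" if "?S m \<le> a" "a < ?S (Suc m)"
  proof (rule antisym)
    show "m \<le> p"
    proof (rule ccontr)
      assume "\<not> m \<le> p"
      then have "?S m0 \<le> ?S m" using p by (intro mono) simp
      then show False using m0 that(1) by linarith
    qed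
    show "p \<le> m"
    proof (rule ccontr)
      assume "\<not> p \<le> m"
      then have "?S (Suc m) \<le> ?S p" by (intro mono) simp
      then show False using le that(2) by linarith
    qed
  qed
  ultimately show ?thesis using le m0 p by auto
qed

context prob_space
begin

lemma yule_familyD:
  assumes "yule_family g s X"
  shows "indep_vars (\<lambda>_. borel) X UNIV"
    and "distributed M lborel (X (Inl (p, m))) (exponential_density g)"
    and "distributed M lborel (X (Inr (u, k))) (exponential_density (s * real (Suc k)))"
    and "X i \<in> borel_measurable M"
  using assms by (auto simp: yule_family_def indep_vars_def)

lemma yule_family_mother: "yule_family g s X \<Longrightarrow> yule_family g s (\<lambda>i. X (mother_clock i))"
  using indep_vars_reindex[of "\<lambda>_. borel" X UNIV mother_clock UNIV, OF _ inj_mother_clock]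
  by (simp add: yule_family_def)

lemma yule_family_daughter: "yule_family g s X \<Longrightarrow> yule_family g s (\<lambda>i. X (daughter_clock i))"
  using indep_vars_reindex[of "\<lambda>_. borel" X UNIV daughter_clock UNIV, OF _ inj_daughter_clock]
  by (simp add: yule_family_def)

lemma AE_yule_family_pos:
  assumes X: "yule_family g s X" and g: "0 < g" and s: "0 < s"
  shows "AE \<omega> in M. \<forall>i. 0 < X i \<omega>"
  unfolding AE_all_countable
proof
  fix i
  have exp0: "AE \<omega> in M. 0 < Y \<omega>" if Y: "distributed M lborel Y (exponential_density l)" and l: "0 < l" for Y l
  proof -
    have [measurable]: "Y \<in> borel_measurable M" using Y by (simp add: distributed_def)
    have "prob {\<omega> \<in> space M. Y \<omega> \<le> 0} = 0"
      using exponential_distributedD_le[OF Y order.refl l] by simp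
    then have "AE \<omega> in M. \<not> Y \<omega> \<le> 0"
      by (subst (asm) prob_eq_0) (auto elim: AE_mp)
    then show ?thesis by (simp add: not_le)
  qed
  show "AE \<omega> in M. 0 < X i \<omega>"
  proof (cases i)
    case (Inl p)
    then show ?thesis using exp0[OF yule_familyD(2)[OF X] g] by (cases p) auto
  next
    case (Inr p)
    then show ?thesis
      using exp0[OF yule_familyD(3)[OF X]] s by (cases p) auto
  qed
qed

lemma emeasure_species_clock_sum_le:
  assumes X: "yule_family g s X" and g: "0 < g" and s: "0 < s"
  shows "emeasure M {\<omega> \<in> space M. (\<Sum>j<k. X (Inr (u, j)) \<omega>) \<le> a} =
    ennreal (if 0 \<le> a then (1 - exp (- s * a)) ^ k else 0)"
proof -
  note [measurable] = yule_familyD(4)[OF X]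
  have neg: "emeasure M {\<omega> \<in> space M. (\<Sum>j<k. X (Inr (u, j)) \<omega>) \<le> a} = 0" if "a < 0" for k a
  proof -
    have "AE \<omega> in M. \<not> (\<Sum>j<k. X (Inr (u, j)) \<omega>) \<le> a"
      using AE_yule_family_pos[OF X g s]
    proof eventually_elim
      case (elim \<omega>)
      have "0 \<le> (\<Sum>j<k. X (Inr (u, j)) \<omega>)" using elim by (intro sum_nonneg) (simp add: less_imp_le)
      then show ?case using that by simp
    qed
    then show ?thesis
      using AE_iff_measurable[of "{\<omega> \<in> space M. (\<Sum>j<k. X (Inr (u, j)) \<omega>) \<le> a}" M
          "\<lambda>\<omega>. \<not> (\<Sum>j<k. X (Inr (u, j)) \<omega>) \<le> a"] by simp
  qed
  show ?thesis
  proof (induction k arbitrary: a)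
    case 0
    then show ?case by (simp add: emeasure_space_1)
  next
    case (Suc k)
    show ?case
    proof (cases "0 \<le> a")
      case False
      then show ?thesis using neg[of a "Suc k"] by (simp del: sum.lessThan_Suc)
    next
      case True
      let ?l = "s * real (Suc k)"
      let ?F = "\<lambda>h. - ((exp (- s * h) - exp (- s * a)) ^ Suc k)"
      let ?f = "\<lambda>h. ?l * exp (- s * h) * (exp (- s * h) - exp (- s * a)) ^ k"
      let ?g = "\<lambda>h. ennreal (if 0 \<le> a - h then (1 - exp (- s * (a - h))) ^ k else 0)"
      have "emeasure M {\<omega> \<in> space M. (\<Sum>j<Suc k. X (Inr (u, j)) \<omega>) \<le> a} =
          (\<integral>\<^sup>+\<omega>'. emeasure M {\<omega> \<in> space M. (\<Sum>j<k. X (Inr (u, j)) \<omega>) + X (Inr (u, k)) \<omega>' \<le> a} \<partial>M)"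
        unfolding sum.lessThan_Suc
      proof (rule indep_vars_Fubini[OF yule_familyD(1)[OF X],
            where R = "\<lambda>x y. (\<Sum>j<k. y (Inr (u, j))) + x (Inr (u, k)) \<le> a"
              and I = "{Inr (u, k)}" and J = "(\<lambda>j. Inr (u, j)) ` {..<k}"])
        show "((\<Sum>j<k. y (Inr (u, j))) + x (Inr (u, k)) \<le> a) = ((\<Sum>j<k. y' (Inr (u, j))) + x' (Inr (u, k)) \<le> a)"
          if "\<And>i. i \<in> {Inr (u, k)} \<Longrightarrow> x i = x' i" "\<And>i. i \<in> (\<lambda>j. Inr (u, j)) ` {..<k} \<Longrightarrow> y i = y' i"
          for x y x' y' :: "clock \<Rightarrow> real"
        proof -
          have "(\<Sum>j<k. y (Inr (u, j))) = (\<Sum>j<k. y' (Inr (u, j)))" by (rule sum.cong) (auto intro: that)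
          then show ?thesis using that(1)[of "Inr (u, k)"] by simp
        qed
      qed (auto, measurable)
      also have "\<dots> = (\<integral>\<^sup>+\<omega>'. ?g (X (Inr (u, k)) \<omega>') \<partial>M)"
      proof (rule nn_integral_cong)
        fix \<omega>'
        have "{\<omega> \<in> space M. (\<Sum>j<k. X (Inr (u, j)) \<omega>) + X (Inr (u, k)) \<omega>' \<le> a} =
            {\<omega> \<in> space M. (\<Sum>j<k. X (Inr (u, j)) \<omega>) \<le> a - X (Inr (u, k)) \<omega>'}" by auto
        then show "emeasure M {\<omega> \<in> space M. (\<Sum>j<k. X (Inr (u, j)) \<omega>) + X (Inr (u, k)) \<omega>' \<le> a} =
          ?g (X (Inr (u, k)) \<omega>')" by (simp only: Suc.IH)
      qed
      also have "\<dots> = (\<integral>\<^sup>+h. ennreal (exponential_density ?l h) * ?g h \<partial>lborel)"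
        by (rule distributed_nn_integral[OF yule_familyD(3)[OF X], symmetric]) measurable
      also have "\<dots> = (\<integral>\<^sup>+h. ennreal (?f h) * indicator {0..a} h \<partial>lborel)"
      proof (rule nn_integral_cong)
        fix h :: real
        have "exp (- h * ?l) = exp (- s * h) * exp (- s * h) ^ k"
          by (simp add: exp_of_nat_mult[symmetric] exp_add[symmetric] algebra_simps)
        moreover have "exp (- s * h) * (1 - exp (- s * (a - h))) = exp (- s * h) - exp (- s * a)"
          by (simp add: algebra_simps exp_add[symmetric])
        ultimately have "?l * exp (- h * ?l) * (1 - exp (- s * (a - h))) ^ k = ?f h"
          by (metis (no_types, lifting) mult.assoc power_mult_distrib)
        moreover have "0 \<le> ?l * exp (- h * ?l)" using s by simp
        ultimately have "h \<le> a \<Longrightarrow> ennreal (?l * exp (- h * ?l)) * ennreal ((1 - exp (- s * (a - h))) ^ k) = ennreal (?f h)"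
          using s by (subst ennreal_mult[symmetric]) (auto intro!: zero_le_power)
        then show "ennreal (exponential_density ?l h) * ?g h = ennreal (?f h) * indicator {0..a} h"
          by (auto simp: exponential_density_def indicator_def)
      qed
      also have "\<dots> = ennreal (?F a - ?F 0)"
      proof (rule nn_integral_FTC_Icc)
        show "?f \<in> borel_measurable borel" by measurable
        fix h :: real assume "h \<in> {0..a}"
        have "((\<lambda>h. exp (- s * h) - exp (- s * a)) has_real_derivative exp (- s * h) * - s) (at h)"
          by (auto intro!: derivative_eq_intros)
        from DERIV_minus[OF DERIV_power_Suc[OF this, of k]]
        show "(?F has_real_derivative ?f h) (at h)"
          by (rule DERIV_cong) (simp add: algebra_simps)
      next
        fix h :: real assume "h \<in> {0..a}"
        then show "0 \<le> ?f h" using s by (auto intro!: mult_nonneg_nonneg zero_le_power)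
      qed fact
      also have "?F a - ?F 0 = (1 - exp (- s * a)) ^ Suc k" by simp
      finally show ?thesis using True by simp
    qed
  qed
qed

lemma emeasure_yule_size_eq:
  assumes X: "yule_family g s X" and g: "0 < g" and s: "0 < s" and a: "0 \<le> a"
  shows "emeasure M {\<omega> \<in> space M. yule_size (species_clock (\<lambda>i. X i \<omega>)) u a = k} = ennreal (yule_prob s a k)"
proof (cases k)
  case 0
  then show ?thesis by (simp add: yule_size_def yule_prob_def)
next
  case (Suc m)
  note [measurable] = yule_familyD(4)[OF X]
  let ?S = "\<lambda>m \<omega>. \<Sum>j<m. X (Inr (u, j)) \<omega>"
  let ?q = "1 - exp (- s * a)"
  have q: "0 \<le> ?q" "?q < 1" using a s by auto
  have le: "prob {\<omega> \<in> space M. ?S m \<omega> \<le> a} = ?q ^ m" for m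
    using emeasure_species_clock_sum_le[OF X g s, where k = m and u = u and a = a] a q by (simp add: emeasure_eq_measure)
  have "prob {\<omega> \<in> space M. \<forall>m. ?S m \<omega> \<le> a} = 0"
  proof (rule antisym)
    show "prob {\<omega> \<in> space M. \<forall>m. ?S m \<omega> \<le> a} \<le> 0"
    proof (rule LIMSEQ_le_const)
      show "(\<lambda>m. ?q ^ m) \<longlonglongrightarrow> 0" using q by (intro LIMSEQ_power_zero) simp
      have "prob {\<omega> \<in> space M. \<forall>m. ?S m \<omega> \<le> a} \<le> ?q ^ m" for m
        unfolding le[symmetric] by (rule finite_measure_mono) auto
      then show "\<exists>N. \<forall>n\<ge>N. prob {\<omega> \<in> space M. \<forall>m. ?S m \<omega> \<le> a} \<le> ?q ^ n" by blast
    qed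
  qed simp
  then have "AE \<omega> in M. \<not> (\<forall>m. ?S m \<omega> \<le> a)" by (subst (asm) prob_eq_0) (auto elim: AE_mp)
  then have ae: "AE \<omega> in M. yule_size (species_clock (\<lambda>i. X i \<omega>)) u a = k \<longleftrightarrow>
      ?S m \<omega> \<le> a \<and> \<not> ?S (Suc m) \<omega> \<le> a"
    using AE_yule_family_pos[OF X g s]
  proof eventually_elim
    case (elim \<omega>)
    then show ?case
      using yule_size_eq_iff[of "species_clock (\<lambda>i. X i \<omega>)" u a m] a Suc
      by (simp add: species_clock_def not_le)
  qed
  have ae': "AE \<omega> in M. ?S (Suc m) \<omega> \<le> a \<longrightarrow> ?S m \<omega> \<le> a"
    using AE_yule_family_pos[OF X g s]
  proof eventually_elim
    case (elim \<omega>)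
    show ?case using elim[rule_format, of "Inr (u, m)"] by auto
  qed
  have "prob {\<omega> \<in> space M. yule_size (species_clock (\<lambda>i. X i \<omega>)) u a = k} =
      prob ({\<omega> \<in> space M. ?S m \<omega> \<le> a} - ({\<omega> \<in> space M. ?S m \<omega> \<le> a} \<inter> {\<omega> \<in> space M. ?S (Suc m) \<omega> \<le> a}))"
    using ae by (intro finite_measure_eq_AE) (auto elim!: AE_mp)
  also have "\<dots> = prob {\<omega> \<in> space M. ?S m \<omega> \<le> a} -
      prob ({\<omega> \<in> space M. ?S m \<omega> \<le> a} \<inter> {\<omega> \<in> space M. ?S (Suc m) \<omega> \<le> a})"
    by (rule finite_measure_Diff) auto
  also have "prob ({\<omega> \<in> space M. ?S m \<omega> \<le> a} \<inter> {\<omega> \<in> space M. ?S (Suc m) \<omega> \<le> a}) =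
      prob {\<omega> \<in> space M. ?S (Suc m) \<omega> \<le> a}"
    using ae' by (intro finite_measure_eq_AE) (auto elim!: AE_mp)
  finally have "prob {\<omega> \<in> space M. yule_size (species_clock (\<lambda>i. X i \<omega>)) u a = k} = ?q ^ m - ?q ^ Suc m"
    unfolding le .
  also have "\<dots> = yule_prob s a k" by (simp add: Suc yule_prob_def algebra_simps)
  finally show ?thesis by (simp add: emeasure_eq_measure)
qed

end

definition yule_kernel :: "real \<Rightarrow> (real \<times> nat) set \<Rightarrow> real \<Rightarrow> ennreal" where
  "yule_kernel s B a = (\<Sum>k. indicator B (a, k) * ennreal (yule_prob s a k))"

lemma measurable_yule_kernel [measurable]:
  assumes [measurable]: "B \<in> sets pair_space"
  shows "yule_kernel s B \<in> borel_measurable borel"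
  unfolding yule_kernel_def yule_prob_def by measurable

lemma (in prob_space) emeasure_yule_size_in:
  assumes X: "yule_family g s X" and g: "0 < g" and s: "0 < s" and a: "0 \<le> a"
  shows "emeasure M {\<omega> \<in> space M. (a, yule_size (species_clock (\<lambda>i. X i \<omega>)) u a) \<in> B} = yule_kernel s B a"
proof -
  note [measurable] = yule_familyD(4)[OF X]
  let ?Y = "\<lambda>\<omega>. yule_size (species_clock (\<lambda>i. X i \<omega>)) u a"
  have [measurable]: "?Y \<in> measurable M (count_space UNIV)" by measurable
  have "emeasure M {\<omega> \<in> space M. (a, ?Y \<omega>) \<in> B} = emeasure (distr M (count_space UNIV) ?Y) {k. (a, k) \<in> B}"
    by (subst emeasure_distr) (auto intro!: arg_cong[where f="emeasure M"])
  also have "\<dots> = (\<integral>\<^sup>+k. emeasure (distr M (count_space UNIV) ?Y) {k} \<partial>count_space {k. (a, k) \<in> B})"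
    by (rule emeasure_countable_singleton) auto
  also have "\<dots> = (\<integral>\<^sup>+k. ennreal (yule_prob s a k) \<partial>count_space {k. (a, k) \<in> B})"
  proof (rule nn_integral_cong)
    fix k
    have "emeasure (distr M (count_space UNIV) ?Y) {k} = emeasure M {\<omega> \<in> space M. ?Y \<omega> = k}"
      by (subst emeasure_distr) (auto intro!: arg_cong[where f="emeasure M"])
    then show "emeasure (distr M (count_space UNIV) ?Y) {k} = ennreal (yule_prob s a k)"
      by (simp add: emeasure_yule_size_eq[OF X g s a])
  qed
  also have "\<dots> = (\<integral>\<^sup>+k. ennreal (yule_prob s a k) * indicator {k. (a, k) \<in> B} k \<partial>count_space UNIV)"
    by (subst nn_integral_count_space_indicator) auto
  also have "\<dots> = yule_kernel s B a"
    unfolding nn_integral_count_space_nat yule_kernel_def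
    by (intro suminf_cong) (auto simp: indicator_def)
  finally show ?thesis .
qed

section \<open>The law of the derived genera\<close>

lemma borel_measurable_indicator_Icc [measurable (raw)]:
  fixes f g :: "'a \<Rightarrow> real"
  assumes [measurable]: "f \<in> borel_measurable N" "g \<in> borel_measurable N"
  shows "(\<lambda>w. indicator {0..f w} (g w) :: ennreal) \<in> borel_measurable N"
  unfolding indicator_def atLeastAtMost_iff by measurable

lemma nn_integral_lborel_reflect:
  fixes f :: "real \<Rightarrow> ennreal"
  assumes "f \<in> borel_measurable borel"
  shows "(\<integral>\<^sup>+x. f x \<partial>lborel) = (\<integral>\<^sup>+x. f (t - x) \<partial>lborel)"
  using nn_integral_real_affine[OF assms, of "-1" t] by simp

lemma nn_integral_product_rule:
  fixes f1 f2 :: "real \<Rightarrow> ennreal"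
  assumes [measurable]: "f1 \<in> borel_measurable borel" "f2 \<in> borel_measurable borel"
  defines "F1 \<equiv> \<lambda>T. \<integral>\<^sup>+a. indicator {0..T} a * f1 a \<partial>lborel"
    and "F2 \<equiv> \<lambda>T. \<integral>\<^sup>+a. indicator {0..T} a * f2 a \<partial>lborel"
  shows "(\<integral>\<^sup>+a. indicator {0..T} a * (f1 a * F2 a + F1 a * f2 a) \<partial>lborel) = F1 T * F2 T"
proof -
  have [measurable]: "F1 \<in> borel_measurable borel" "F2 \<in> borel_measurable borel"
    unfolding F1_def F2_def by measurable
  have "(\<integral>\<^sup>+a. indicator {0..T} a * (F1 a * f2 a) \<partial>lborel) =
      (\<integral>\<^sup>+b. \<integral>\<^sup>+a. indicator {0..T} b * f2 b * (indicator {0..b} a * f1 a) \<partial>lborel \<partial>lborel)"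
    unfolding F1_def by (intro nn_integral_cong) (subst nn_integral_cmult, measurable, simp add: mult_ac)
  also have "\<dots> = (\<integral>\<^sup>+a. \<integral>\<^sup>+b. indicator {0..T} b * f2 b * (indicator {0..b} a * f1 a) \<partial>lborel \<partial>lborel)"
    by (rule lborel_pair.Fubini') measurable
  finally have 2: "(\<integral>\<^sup>+a. indicator {0..T} a * (F1 a * f2 a) \<partial>lborel) =
      (\<integral>\<^sup>+a. \<integral>\<^sup>+b. indicator {0..T} b * f2 b * (indicator {0..b} a * f1 a) \<partial>lborel \<partial>lborel)" .
  have 1: "(\<integral>\<^sup>+a. indicator {0..T} a * (f1 a * F2 a) \<partial>lborel) =
      (\<integral>\<^sup>+a. \<integral>\<^sup>+b. indicator {0..T} a * f1 a * (indicator {0..a} b * f2 b) \<partial>lborel \<partial>lborel)"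
    unfolding F2_def by (intro nn_integral_cong) (subst nn_integral_cmult, measurable, simp add: mult_ac)
  have "(\<integral>\<^sup>+a. indicator {0..T} a * (f1 a * F2 a + F1 a * f2 a) \<partial>lborel) =
      (\<integral>\<^sup>+a. indicator {0..T} a * (f1 a * F2 a) \<partial>lborel) + (\<integral>\<^sup>+a. indicator {0..T} a * (F1 a * f2 a) \<partial>lborel)"
    by (subst nn_integral_add[symmetric]) (auto simp: distrib_left)
  also have "\<dots> = (\<integral>\<^sup>+a. (\<integral>\<^sup>+b. indicator {0..T} a * f1 a * (indicator {0..a} b * f2 b) \<partial>lborel) +
      (\<integral>\<^sup>+b. indicator {0..T} b * f2 b * (indicator {0..b} a * f1 a) \<partial>lborel) \<partial>lborel)"
    unfolding 1 2 by (rule nn_integral_add[symmetric]) measurable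
  also have "\<dots> = (\<integral>\<^sup>+a. (\<integral>\<^sup>+b. indicator {0..T} a * f1 a * (indicator {0..a} b * f2 b) +
      indicator {0..T} b * f2 b * (indicator {0..b} a * f1 a) \<partial>lborel) \<partial>lborel)"
    by (intro nn_integral_cong nn_integral_add[symmetric]) measurable
  also have "\<dots> = (\<integral>\<^sup>+a. (\<integral>\<^sup>+b. indicator {0..T} a * f1 a * (indicator {0..T} b * f2 b) \<partial>lborel) \<partial>lborel)"
  proof (rule nn_integral_cong)
    fix a :: real
    show "(\<integral>\<^sup>+b. indicator {0..T} a * f1 a * (indicator {0..a} b * f2 b) +
      indicator {0..T} b * f2 b * (indicator {0..b} a * f1 a) \<partial>lborel) =
      (\<integral>\<^sup>+b. indicator {0..T} a * f1 a * (indicator {0..T} b * f2 b) \<partial>lborel)"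
    proof (rule nn_integral_cong_AE)
      show "AE b in lborel. indicator {0..T} a * f1 a * (indicator {0..a} b * f2 b) +
        indicator {0..T} b * f2 b * (indicator {0..b} a * f1 a) =
        indicator {0..T} a * f1 a * (indicator {0..T} b * f2 b)"
        using AE_lborel_singleton[of a]
        by eventually_elim (auto simp: indicator_def mult_ac)
    qed
  qed
  also have "\<dots> = F1 T * F2 T"
    unfolding F1_def F2_def by (simp add: nn_integral_cmult nn_integral_multc)
  finally show ?thesis .
qed

text \<open>The summand with index \<open>j\<close> accounts for the points whose largest coordinate is the \<open>j\<close>-th.\<close>
lemma nn_integral_product_rule_prod:
  fixes f :: "nat \<Rightarrow> real \<Rightarrow> ennreal"
  assumes f: "\<And>i. f i \<in> borel_measurable borel"
  defines "F \<equiv> \<lambda>i T. \<integral>\<^sup>+a. indicator {0..T} a * f i a \<partial>lborel"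
  shows "(\<integral>\<^sup>+a. indicator {0..T} a *
      (\<Sum>j\<le>n. (\<Prod>i<j. F i a) * f j a * (\<Prod>i<n - j. F (Suc (i + j)) a)) \<partial>lborel) = (\<Prod>i<Suc n. F i T)"
proof (induction n arbitrary: T)
  case 0
  then show ?case by (simp add: F_def)
next
  case (Suc n)
  note [measurable] = f
  have F_eq: "F i T = (\<integral>\<^sup>+a. indicator {0..T} a * f i a \<partial>lborel)" for i T
    by (simp add: F_def)
  have [measurable]: "F i \<in> borel_measurable borel" for i
    unfolding F_def by measurable
  let ?D = "\<lambda>n a. \<Sum>j\<le>n. (\<Prod>i<j. F i a) * f j a * (\<Prod>i<n - j. F (Suc (i + j)) a)"
  have [measurable]: "?D n \<in> borel_measurable borel" by measurable
  have "?D (Suc n) a = ?D n a * F (Suc n) a + (\<Prod>i<Suc n. F i a) * f (Suc n) a" for a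
  proof -
    have "(\<Sum>j\<le>n. (\<Prod>i<j. F i a) * f j a * (\<Prod>i<Suc n - j. F (Suc (i + j)) a)) = ?D n a * F (Suc n) a"
      unfolding sum_distrib_right by (rule sum.cong) (auto simp: Suc_diff_le mult_ac)
    then show ?thesis by (simp only: sum.atMost_Suc) simp
  qed
  then have "(\<integral>\<^sup>+a. indicator {0..T} a * ?D (Suc n) a \<partial>lborel) =
      (\<integral>\<^sup>+a. indicator {0..T} a * (?D n a * F (Suc n) a + (\<Prod>i<Suc n. F i a) * f (Suc n) a) \<partial>lborel)"
    by (simp only:)
  also have "\<dots> = (\<Prod>i<Suc n. F i T) * F (Suc n) T"
    using nn_integral_product_rule[of "?D n" "f (Suc n)" T] f
    unfolding Suc.IH F_eq[symmetric] by simp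
  finally show ?case by simp
qed

definition age_size_density :: "real \<Rightarrow> real \<Rightarrow> (real \<times> nat) set \<Rightarrow> real \<Rightarrow> ennreal" where
  "age_size_density g s B a = ennreal (g * exp (- g * a)) * yule_kernel s B a"

definition age_size_measure :: "real \<Rightarrow> real \<Rightarrow> real \<Rightarrow> (real \<times> nat) set \<Rightarrow> ennreal" where
  "age_size_measure g s T B = (\<integral>\<^sup>+a. indicator {0..T} a * age_size_density g s B a \<partial>lborel)"

lemma measurable_age_size_density [measurable]:
  assumes [measurable]: "B \<in> sets pair_space"
  shows "age_size_density g s B \<in> borel_measurable borel"
  unfolding age_size_density_def by measurable

lemma measurable_age_size_measure [measurable]:
  assumes [measurable]: "B \<in> sets pair_space"
  shows "(\<lambda>T. age_size_measure g s T B) \<in> borel_measurable borel"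
  unfolding age_size_measure_def by measurable

context prob_space
begin

lemma emeasure_planar_event:
  assumes "yule_family g s X" "0 < g" "0 < s" "0 \<le> T" "\<And>i. B i \<in> sets pair_space"
  shows "emeasure M {\<omega> \<in> space M. planar_event n T (\<lambda>i. X i \<omega>) B} =
    ennreal (exp (- g * T)) * (\<Prod>i<n. age_size_measure g s T (B i))"
  using assms
proof (induction n arbitrary: T X B rule: less_induct)
  case (less n)
  note X = less.prems(1) and g = less.prems(2) and s = less.prems(3) and T = less.prems(4)
  note B [measurable] = less.prems(5)
  note [measurable] = yule_familyD(4)[OF X]
  show ?case
  proof (cases n)
    case 0
    have "prob {\<omega> \<in> space M. T < X first_clock \<omega>} = exp (- T * g)"
      by (rule exponential_distributedD_gt[OF yule_familyD(2)[OF X] T g])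
    then show ?thesis by (simp add: 0 emeasure_eq_measure mult.commute)
  next
    case (Suc k)
    let ?Q = "\<lambda>a (y :: clock \<Rightarrow> real) j. planar_event j a (y \<circ> mother_clock) B \<and>
        (a, yule_size (species_clock y) [0] a) \<in> B j \<and>
        planar_event (k - j) a (y \<circ> daughter_clock) (\<lambda>i. B (Suc (i + j)))"
    let ?R = "\<lambda>x y :: clock \<Rightarrow> real. x first_clock \<le> T \<and> (\<exists>j\<in>{..k}. ?Q (T - x first_clock) y j)"
    let ?\<alpha> = "\<lambda>i a. age_size_measure g s a (B i)"
    let ?\<psi> = "\<lambda>a. \<Sum>j\<le>k. (ennreal (exp (- g * a)) * (\<Prod>i<j. ?\<alpha> i a)) * (yule_kernel s (B j) a *
        (ennreal (exp (- g * a)) * (\<Prod>i<k - j. ?\<alpha> (Suc (i + j)) a)))"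
    have Q: "emeasure M {\<omega> \<in> space M. \<exists>j\<in>{..k}. ?Q a (\<lambda>i. X i \<omega>) j} = ?\<psi> a" if a: "0 \<le> a" for a
    proof -
      note [measurable (raw)] = pred_planar_event
      have "emeasure M {\<omega> \<in> space M. \<exists>j\<in>{..k}. ?Q a (\<lambda>i. X i \<omega>) j} =
          emeasure M (\<Union>j\<in>{..k}. {\<omega> \<in> space M. ?Q a (\<lambda>i. X i \<omega>) j})"
        by (rule arg_cong[where f="emeasure M"]) auto
      also have "\<dots> = (\<Sum>j\<le>k. emeasure M {\<omega> \<in> space M. ?Q a (\<lambda>i. X i \<omega>) j})"
      proof (rule sum_emeasure[symmetric])
        show "(\<lambda>j. {\<omega> \<in> space M. ?Q a (\<lambda>i. X i \<omega>) j}) ` {..k} \<subseteq> events"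
          by (auto simp: comp_def)
        show "disjoint_family_on (\<lambda>j. {\<omega> \<in> space M. ?Q a (\<lambda>i. X i \<omega>) j}) {..k}"
          unfolding disjoint_family_on_def using planar_event_unique by blast
      qed simp
      also have "\<dots> = ?\<psi> a"
      proof (rule sum.cong[OF refl])
        fix j assume "j \<in> {..k}"
        then have j: "j < n" "k - j < n" using Suc by auto
        let ?P1 = "\<lambda>y :: clock \<Rightarrow> real. planar_event j a (y \<circ> mother_clock) B"
        let ?P2 = "\<lambda>y :: clock \<Rightarrow> real. (a, yule_size (species_clock y) [0] a) \<in> B j"
        let ?P3 = "\<lambda>y :: clock \<Rightarrow> real. planar_event (k - j) a (y \<circ> daughter_clock) (\<lambda>i. B (Suc (i + j)))"
        have [measurable]: "Measurable.pred (Pi\<^sub>M UNIV (\<lambda>_. borel)) ?P1"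
          "Measurable.pred (Pi\<^sub>M UNIV (\<lambda>_. borel)) ?P2" "Measurable.pred (Pi\<^sub>M UNIV (\<lambda>_. borel)) ?P3"
          by (auto simp: comp_def)
        have P2_dep: "?P2 x = ?P2 x'" if "\<And>k. x (Inr ([0], k)) = x' (Inr ([0], k))" for x x'
          using that by (simp add: yule_size_def species_clock_def)
        have "emeasure M {\<omega> \<in> space M. ?P1 (\<lambda>i. X i \<omega>) \<and> (?P2 (\<lambda>i. X i \<omega>) \<and> ?P3 (\<lambda>i. X i \<omega>))} =
            emeasure M {\<omega> \<in> space M. ?P1 (\<lambda>i. X i \<omega>)} * emeasure M {\<omega> \<in> space M. ?P2 (\<lambda>i. X i \<omega>) \<and> ?P3 (\<lambda>i. X i \<omega>)}"
        proof (rule indep_vars_disjoint_events[OF yule_familyD(1)[OF X],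
              where I = "range mother_clock" and J = "range daughter_clock"
                and P = ?P1 and Q = "\<lambda>y. ?P2 y \<and> ?P3 y"])
          show "range mother_clock \<inter> range daughter_clock = {}"
          proof -
            have "mother_clock i \<noteq> daughter_clock i'" for i i'
              by (cases i rule: mother_clock.cases; cases i' rule: daughter_clock.cases;
                  auto elim: mother_word.elims)
            then show ?thesis by blast
          qed
          show "?P1 x = ?P1 x'" if "\<And>i. i \<in> range mother_clock \<Longrightarrow> x i = x' i" for x x'
          proof -
            have "x \<circ> mother_clock = x' \<circ> mother_clock" using that by auto
            then show ?thesis by simp
          qed
          show "(?P2 x \<and> ?P3 x) = (?P2 x' \<and> ?P3 x')" if *: "\<And>i. i \<in> range daughter_clock \<Longrightarrow> x i = x' i" for x x'
          proof -
            have "x \<circ> daughter_clock = x' \<circ> daughter_clock" using that by auto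
            moreover have "x (Inr ([0], k)) = x' (Inr ([0], k))" for k
              by (rule *) (rule image_eqI[of _ _ "Inr ([], k)"], auto)
            ultimately show ?thesis using P2_dep[of x x'] by simp
          qed
        qed measurable
        also have "emeasure M {\<omega> \<in> space M. ?P2 (\<lambda>i. X i \<omega>) \<and> ?P3 (\<lambda>i. X i \<omega>)} =
            emeasure M {\<omega> \<in> space M. ?P2 (\<lambda>i. X i \<omega>)} * emeasure M {\<omega> \<in> space M. ?P3 (\<lambda>i. X i \<omega>)}"
        proof (rule indep_vars_disjoint_events[OF yule_familyD(1)[OF X],
              where I = "range (\<lambda>k. Inr ([0], k))" and J = "- range (\<lambda>k. Inr ([0], k))"
                and P = ?P2 and Q = ?P3])
          show "?P2 x = ?P2 x'" if "\<And>i. i \<in> range (\<lambda>k. Inr ([0], k)) \<Longrightarrow> x i = x' i" for x x'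
            by (rule P2_dep) (rule that, blast)
          show "?P3 x = ?P3 x'" if *: "\<And>i. i \<in> - range (\<lambda>k. Inr ([0], k)) \<Longrightarrow> x i = x' i" for x x'
          proof (rule planar_event_cong)
            fix i :: clock assume "i \<notin> Inr ` ({[]} \<times> UNIV)"
            then show "(x \<circ> daughter_clock) i = (x' \<circ> daughter_clock) i"
              unfolding comp_def by (intro *) (cases i rule: daughter_clock.cases; auto)
          qed
        qed (blast, measurable)
        also have "emeasure M {\<omega> \<in> space M. ?P1 (\<lambda>i. X i \<omega>)} = ennreal (exp (- g * a)) * (\<Prod>i<j. ?\<alpha> i a)"
          using less.IH[OF j(1) yule_family_mother[OF X] g s a B] by (simp add: comp_def)
        also have "emeasure M {\<omega> \<in> space M. ?P2 (\<lambda>i. X i \<omega>)} = yule_kernel s (B j) a"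
          by (rule emeasure_yule_size_in[OF X g s a])
        also have "emeasure M {\<omega> \<in> space M. ?P3 (\<lambda>i. X i \<omega>)} =
            ennreal (exp (- g * a)) * (\<Prod>i<k - j. ?\<alpha> (Suc (i + j)) a)"
          using less.IH[OF j(2) yule_family_daughter[OF X] g s a, of "\<lambda>i. B (Suc (i + j))"] B by (simp add: comp_def)
        finally show "emeasure M {\<omega> \<in> space M. ?Q a (\<lambda>i. X i \<omega>) j} =
            (ennreal (exp (- g * a)) * (\<Prod>i<j. ?\<alpha> i a)) * (yule_kernel s (B j) a *
            (ennreal (exp (- g * a)) * (\<Prod>i<k - j. ?\<alpha> (Suc (i + j)) a)))" .
      qed
      finally show ?thesis .
    qed
    let ?\<Psi> = "\<lambda>e. if e \<le> T then ?\<psi> (T - e) else 0"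
    have meas [measurable]: "?\<psi> \<in> borel_measurable borel" by measurable
    have "emeasure M {\<omega> \<in> space M. planar_event n T (\<lambda>i. X i \<omega>) B} =
        emeasure M {\<omega> \<in> space M. ?R (\<lambda>i. X i \<omega>) (\<lambda>i. X i \<omega>)}"
      by (simp add: Suc)
    also have "\<dots> = (\<integral>\<^sup>+\<omega>'. emeasure M {\<omega> \<in> space M. ?R (\<lambda>i. X i \<omega>') (\<lambda>i. X i \<omega>)} \<partial>M)"
    proof (rule indep_vars_Fubini[OF yule_familyD(1)[OF X], where R = ?R and I = "{first_clock}" and J = "- {first_clock}"])
      note [measurable (raw)] = pred_planar_event
      show "Measurable.pred (Pi\<^sub>M UNIV (\<lambda>_. borel) \<Otimes>\<^sub>M Pi\<^sub>M UNIV (\<lambda>_. borel)) (\<lambda>(x, y). ?R x y)"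
        unfolding case_prod_beta' comp_def
        by (intro pred_intros_logic pred_intros_finite finite_atMost) auto
      show "?R x y = ?R x' y'" if "\<And>i. i \<in> {first_clock} \<Longrightarrow> x i = x' i" "\<And>i. i \<in> - {first_clock} \<Longrightarrow> y i = y' i"
        for x y x' y'
      proof -
        have "x first_clock = x' first_clock" using that by simp
        moreover have "y (mother_clock i) = y' (mother_clock i)" for i
          by (rule that(2)) (cases i rule: mother_clock.cases; auto)
        then have "y \<circ> mother_clock = y' \<circ> mother_clock" by auto
        moreover have "y (daughter_clock i) = y' (daughter_clock i)" for i
          by (rule that(2)) (cases i rule: daughter_clock.cases; auto)
        then have "y \<circ> daughter_clock = y' \<circ> daughter_clock" by auto
        moreover have "species_clock y [0] = species_clock y' [0]"
          unfolding species_clock_def by (rule ext, rule that(2)) auto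
        ultimately show ?thesis by (simp add: yule_size_def)
      qed
    qed blast
    also have "\<dots> = (\<integral>\<^sup>+\<omega>'. ?\<Psi> (X first_clock \<omega>') \<partial>M)"
    proof (rule nn_integral_cong)
      fix \<omega>'
      show "emeasure M {\<omega> \<in> space M. ?R (\<lambda>i. X i \<omega>') (\<lambda>i. X i \<omega>)} = ?\<Psi> (X first_clock \<omega>')"
        using Q[of "T - X first_clock \<omega>'"] by (cases "X first_clock \<omega>' \<le> T") simp_all
    qed
    also have "\<dots> = (\<integral>\<^sup>+e. ennreal (exponential_density g e) * ?\<Psi> e \<partial>lborel)"
      by (rule distributed_nn_integral[OF yule_familyD(2)[OF X], symmetric]) measurable
    also have "\<dots> = (\<integral>\<^sup>+a. ennreal (exponential_density g (T - a)) * ?\<Psi> (T - a) \<partial>lborel)"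
      by (rule nn_integral_lborel_reflect) measurable
    also have "\<dots> = (\<integral>\<^sup>+a. ennreal (exp (- g * T)) * (indicator {0..T} a *
        (\<Sum>j\<le>k. (\<Prod>i<j. ?\<alpha> i a) * age_size_density g s (B j) a * (\<Prod>i<k - j. ?\<alpha> (Suc (i + j)) a))) \<partial>lborel)"
    proof (rule nn_integral_cong)
      fix a :: real
      have "g * exp (- (T - a) * g) * exp (- g * a) = exp (- g * T) * g"
        by (simp add: exp_add[symmetric] algebra_simps)
      then have "ennreal (g * exp (- (T - a) * g)) * ennreal (exp (- g * a)) = ennreal (exp (- g * T)) * ennreal g"
        using g by (simp add: ennreal_mult[symmetric])
      then have *: "ennreal (g * exp (- (T - a) * g)) * (ennreal (exp (- g * a)) * p * (q * (ennreal (exp (- g * a)) * r))) =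
          ennreal (exp (- g * T)) * (p * (ennreal (g * exp (- g * a)) * q) * r)" for p q r
        using g by (simp add: ennreal_mult mult_ac)
      show "ennreal (exponential_density g (T - a)) * ?\<Psi> (T - a) = ennreal (exp (- g * T)) * (indicator {0..T} a *
        (\<Sum>j\<le>k. (\<Prod>i<j. ?\<alpha> i a) * age_size_density g s (B j) a * (\<Prod>i<k - j. ?\<alpha> (Suc (i + j)) a)))"
      proof (cases "0 \<le> a \<and> a \<le> T")
        case True
        have "ennreal (exponential_density g (T - a)) = ennreal (g * exp (- (T - a) * g))"
          using True by (simp add: exponential_density_def)
        moreover have "?\<Psi> (T - a) = ?\<psi> a" "indicator {0..T} a = (1 :: ennreal)"
          using True by simp_all
        ultimately show ?thesis
          by (simp only: sum_distrib_left * mult_1_left age_size_density_def)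
      next
        case False
        then show ?thesis by (auto simp: exponential_density_def)
      qed
    qed
    also have "\<dots> = ennreal (exp (- g * T)) * (\<integral>\<^sup>+a. indicator {0..T} a *
        (\<Sum>j\<le>k. (\<Prod>i<j. ?\<alpha> i a) * age_size_density g s (B j) a * (\<Prod>i<k - j. ?\<alpha> (Suc (i + j)) a)) \<partial>lborel)"
      by (rule nn_integral_cmult) measurable
    also have "\<dots> = ennreal (exp (- g * T)) * (\<Prod>i<Suc k. ?\<alpha> i T)"
      unfolding age_size_measure_def
      by (subst nn_integral_product_rule_prod) auto
    finally show ?thesis by (simp only: Suc)
  qed
qed

end

section \<open>Comparison with the killed sequence\<close>

lemma UNIV_in_pair_space [simp]: "UNIV \<in> sets pair_space"
  using sets.top[of pair_space] by (simp add: space_pair_measure)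

lemma emeasure_AS_law:
  assumes [measurable]: "B \<in> sets pair_space" and g: "0 < g" and s: "0 < s"
  shows "emeasure (AS_law g s) (B \<inter> {..T} \<times> UNIV) = age_size_measure g s T B"
proof -
  let ?d = "\<lambda>a k. ennreal (if 0 < a \<and> 1 \<le> k
        then g * exp (- (g + s) * a) * (1 - exp (- s * a)) ^ (k - 1) else 0)"
  interpret count: sigma_finite_measure "count_space (UNIV :: nat set)"
    by (rule sigma_finite_measure_count_space)
  have [measurable]: "(\<lambda>(a, k). ?d a k) \<in> borel_measurable (lborel \<Otimes>\<^sub>M count_space UNIV)"
  proof -
    have "(\<lambda>p. (\<lambda>k p. ?d (fst p) k) (snd p) p) \<in> borel_measurable (lborel \<Otimes>\<^sub>M count_space UNIV)"
      by (rule measurable_compose_countable) measurable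
    then show ?thesis by (simp add: case_prod_beta')
  qed
  have sets: "sets pair_space = sets (lborel \<Otimes>\<^sub>M count_space (UNIV :: nat set))"
    by (intro sets_pair_measure_cong) auto
  have BT: "B \<inter> {..T} \<times> UNIV \<in> sets (lborel \<Otimes>\<^sub>M count_space UNIV)"
    unfolding sets[symmetric] by measurable
  have "emeasure (AS_law g s) (B \<inter> {..T} \<times> UNIV) =
     (\<integral>\<^sup>+p. (case p of (a, k) \<Rightarrow> ?d a k) * indicator (B \<inter> {..T} \<times> UNIV) p \<partial>(lborel \<Otimes>\<^sub>M count_space UNIV))"
    unfolding AS_law_def using BT by (rule emeasure_density[rotated]) measurable
  also have "\<dots> = (\<integral>\<^sup>+a. \<integral>\<^sup>+k. ?d a k * indicator (B \<inter> {..T} \<times> UNIV) (a, k) \<partial>count_space UNIV \<partial>lborel)"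
    using BT by (subst count.nn_integral_fst[symmetric]) auto
  also have "\<dots> = age_size_measure g s T B"
    unfolding age_size_measure_def
  proof (rule nn_integral_cong_AE)
    show "AE a in lborel. (\<integral>\<^sup>+k. ?d a k * indicator (B \<inter> {..T} \<times> UNIV) (a, k) \<partial>count_space UNIV) =
       indicator {0..T} a * age_size_density g s B a"
      using AE_lborel_singleton[of 0]
    proof eventually_elim
      case (elim a)
      show ?case
      proof (cases "0 < a \<and> a \<le> T")
        case True
        have "?d a k * indicator (B \<inter> {..T} \<times> UNIV) (a, k) =
            ennreal (g * exp (- g * a)) * (indicator B (a, k) * ennreal (yule_prob s a k))" for k
        proof -
          have "(if 0 < a \<and> 1 \<le> k then g * exp (- (g + s) * a) * (1 - exp (- s * a)) ^ (k - 1) else 0) =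
              (g * exp (- g * a)) * yule_prob s a k"
            using True by (simp add: yule_prob_def exp_add[symmetric] algebra_simps)
          moreover have "0 \<le> yule_prob s a k" using True s by (simp add: yule_prob_def)
          ultimately show ?thesis
            using True g by (simp add: ennreal_mult indicator_def)
        qed
        then show ?thesis
          using True unfolding nn_integral_count_space_nat age_size_density_def yule_kernel_def
          by (simp add: ennreal_suminf_cmult)
      next
        case False
        then have "?d a k * indicator (B \<inter> {..T} \<times> UNIV) (a, k) = 0" for k
          by (auto simp: indicator_def)
        moreover have "indicator {0..T} a = (0 :: ennreal)" using False elim by auto
        ultimately show ?thesis by (simp only:) simp
      qed
    qed
  qed
  finally show ?thesis .
qed

lemma (in prob_space) age_size_measure_UNIV:
  assumes X: "yule_family g s X" and g: "0 < g" and s: "0 < s" and T: "0 \<le> T"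
  shows "age_size_measure g s T UNIV = ennreal (1 - exp (- g * T))"
proof -
  have "age_size_measure g s T UNIV = (\<integral>\<^sup>+a. ennreal (g * exp (- g * a)) * indicator {0..T} a \<partial>lborel)"
    unfolding age_size_measure_def
  proof (rule nn_integral_cong)
    fix a
    show "indicator {0..T} a * age_size_density g s UNIV a = ennreal (g * exp (- g * a)) * indicator {0..T} a"
      using emeasure_yule_size_in[OF X g s, of a _ UNIV]
      by (auto simp: indicator_def age_size_density_def emeasure_space_1)
  qed
  also have "\<dots> = ennreal ((- exp (- g * T)) - (- exp (- g * 0)))"
    using g T by (intro nn_integral_FTC_Icc) (auto intro!: derivative_eq_intros)
  finally show ?thesis by simp
qed

lemma measurable_genus_birth [measurable (raw)]:
  assumes [measurable]: "\<And>i. (\<lambda>w. x w i) \<in> borel_measurable N"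
  shows "(\<lambda>w. genus_birth (genus_clock (x w)) u) \<in> borel_measurable N"
proof -
  have "(\<lambda>w. birth_from (genus_clock (x w)) p u) \<in> borel_measurable N" for p
    by (induction u arbitrary: p) (simp_all add: genus_clock_def)
  then show ?thesis by (simp add: genus_birth_def)
qed

lemma measurable_card_words:
  fixes S :: "'a \<Rightarrow> nat list set"
  assumes "\<And>u. Measurable.pred N (\<lambda>w. u \<in> S w)"
  shows "(\<lambda>w. card (S w)) \<in> measurable N (count_space UNIV)"
proof -
  have "{w \<in> space N. i \<in> to_nat ` S w} \<in> sets N" for i
  proof -
    have "i \<in> to_nat ` S w \<longleftrightarrow> to_nat (from_nat i :: nat list) = i \<and> from_nat i \<in> S w" for w
      by (metis (no_types, lifting) from_nat_to_nat image_iff)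
    then have "Measurable.pred N (\<lambda>w. i \<in> to_nat ` S w)" using assms by simp
    then show ?thesis by (simp add: pred_def)
  qed
  then have "(\<lambda>w. card (to_nat ` S w)) \<in> measurable N (count_space UNIV)" by (rule measurable_card)
  then show ?thesis by (simp add: card_image inj_on_subset[OF inj_to_nat])
qed

context
  fixes N :: "'a measure" and x :: "'a \<Rightarrow> clock \<Rightarrow> real"
  assumes x [measurable]: "\<And>i. (\<lambda>w. x w i) \<in> borel_measurable N"
begin

lemma pred_present_genera: "Measurable.pred N (\<lambda>w. u \<in> present_genera (genus_clock (x w)) T)"
  unfolding present_genera_def by simp

lemma measurable_num_genera: "(\<lambda>w. num_genera (genus_clock (x w)) T) \<in> measurable N (count_space UNIV)"
  unfolding num_genera_def by (rule measurable_card_words) (rule pred_present_genera)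

text \<open>For positive labels the description in \<^const>\<open>genus_label\<close> has at most one solution even when
  infinitely many genera are present, so on the exceptional set it takes one fixed junk value.\<close>
lemma measurable_genus_label:
  "(\<lambda>w. genus_label (genus_clock (x w)) T (Suc i)) \<in> measurable N (count_space UNIV)"
  unfolding genus_label_def
proof (rule measurable_THE[where I = UNIV])
  fix u
  have [measurable]: "(\<lambda>w. card {v \<in> present_genera (genus_clock (x w)) T. planar_before v u}) \<in> measurable N (count_space UNIV)"
    using pred_present_genera by (intro measurable_card_words) simp
  show "Measurable.pred N (\<lambda>w. u \<in> present_genera (genus_clock (x w)) T \<and>
      card {v \<in> present_genera (genus_clock (x w)) T. planar_before v u} = Suc i)"
    by (intro pred_intros_logic pred_present_genera) measurable
qed (auto intro: genus_label_unique)

lemma measurable_genus_age_size: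
  "(\<lambda>w. (genus_age (genus_clock (x w)) T (Suc i),
     genus_size (genus_clock (x w)) (species_clock (x w)) T (Suc i))) \<in> measurable N pair_space"
proof (rule measurable_Pair)
  note [measurable] = measurable_genus_label
  show age [measurable]: "(\<lambda>w. genus_age (genus_clock (x w)) T (Suc i)) \<in> borel_measurable N"
    unfolding genus_age_def
    by (rule measurable_compose_countable[where f = "\<lambda>u w. T - genus_birth (genus_clock (x w)) u"]) measurable
  show "(\<lambda>w. genus_size (genus_clock (x w)) (species_clock (x w)) T (Suc i)) \<in> measurable N (count_space UNIV)"
    unfolding genus_size_def
    by (rule measurable_compose_countable[where f = "\<lambda>u w. yule_size (species_clock (x w)) u (genus_age (genus_clock (x w)) T (Suc i))"]) measurable
qed

end

lemma emeasure_eqI_PiM_finite: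
  assumes M: "finite_measure M" and I: "finite I"
    and V: "V \<in> measurable M (Pi\<^sub>M I P)" and V': "V' \<in> measurable N (Pi\<^sub>M I P)"
    and W: "Measurable.pred M W" and W': "Measurable.pred N W'"
    and eq: "\<And>A. (\<And>i. i \<in> I \<Longrightarrow> A i \<in> sets (P i)) \<Longrightarrow>
      emeasure M {\<omega> \<in> space M. W \<omega> \<and> (\<forall>i\<in>I. V \<omega> i \<in> A i)} = emeasure N {\<omega> \<in> space N. W' \<omega> \<and> (\<forall>i\<in>I. V' \<omega> i \<in> A i)}"
    and B: "B \<in> sets (Pi\<^sub>M I P)"
  shows "emeasure M {\<omega> \<in> space M. W \<omega> \<and> V \<omega> \<in> B} = emeasure N {\<omega> \<in> space N. W' \<omega> \<and> V' \<omega> \<in> B}"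
proof -
  interpret finite_measure M by fact
  let ?law = "\<lambda>M W V. distr (density M (indicator {\<omega> \<in> space M. W \<omega>})) (Pi\<^sub>M I P) V"
  have law: "emeasure (?law M W V) B = emeasure M {\<omega> \<in> space M. W \<omega> \<and> V \<omega> \<in> B}"
    if "V \<in> measurable M (Pi\<^sub>M I P)" "Measurable.pred M W" "B \<in> sets (Pi\<^sub>M I P)"
    for M :: "'x measure" and W V B
  proof -
    have "emeasure (?law M W V) B = emeasure (density M (indicator {\<omega> \<in> space M. W \<omega>})) (V -` B \<inter> space M)"
      using that by (subst emeasure_distr) auto
    also have "\<dots> = emeasure M ({\<omega> \<in> space M. W \<omega>} \<inter> (V -` B \<inter> space M))"
      using that by (intro emeasure_restricted) (auto simp: pred_def)
    also have "{\<omega> \<in> space M. W \<omega>} \<inter> (V -` B \<inter> space M) = {\<omega> \<in> space M. W \<omega> \<and> V \<omega> \<in> B}" by auto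
    finally show ?thesis .
  qed
  have rect: "emeasure (?law M W V) (Pi\<^sub>E I A) = emeasure M {\<omega> \<in> space M. W \<omega> \<and> (\<forall>i\<in>I. V \<omega> i \<in> A i)}"
    if V: "V \<in> measurable M (Pi\<^sub>M I P)" and "Measurable.pred M W" "\<And>i. i \<in> I \<Longrightarrow> A i \<in> sets (P i)"
    for M :: "'x measure" and W V A
  proof -
    have "V \<omega> \<in> Pi\<^sub>E I A \<longleftrightarrow> (\<forall>i\<in>I. V \<omega> i \<in> A i)" if "\<omega> \<in> space M" for \<omega>
      using measurable_space[OF V that] by (auto simp: space_PiM PiE_iff)
    then show ?thesis
      using that sets_PiM_I_finite[OF I, of A P] by (subst law) (auto intro!: arg_cong[where f="emeasure M"])
  qed
  have "?law M W V = ?law N W' V'"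
  proof (rule measure_eqI_PiM_finite[OF I])
    show "emeasure (?law M W V) (Pi\<^sub>E I A) = emeasure (?law N W' V') (Pi\<^sub>E I A)"
      if "\<And>i. i \<in> I \<Longrightarrow> A i \<in> sets (P i)" for A
      using that by (simp add: rect[OF V W] rect[OF V' W'] eq)
    show "range (\<lambda>_::nat. \<Pi>\<^sub>E i\<in>I. space (P i)) \<subseteq> prod_algebra I P"
      using I by (auto intro!: prod_algebraI_finite)
    show "(\<Union>i::nat. \<Pi>\<^sub>E i\<in>I. space (P i)) = space (Pi\<^sub>M I P)" by (simp add: space_PiM)
    show "emeasure (?law M W V) (\<Pi>\<^sub>E i\<in>I. space (P i)) \<noteq> \<infinity>" for i :: nat
      using V W by (simp add: rect emeasure_eq_measure)
  qed auto
  then show ?thesis using law[OF V W B] law[OF V' W' B] by simp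
qed

lemma (in prob_space) emeasure_genera_rectangle:
  assumes X: "yule_family g s X" and g: "0 < g" and s: "0 < s" and T: "0 \<le> T"
    and A: "\<And>i. A i \<in> sets pair_space"
  shows "emeasure M {\<omega> \<in> space M. num_genera (genus_clock (\<lambda>i. X i \<omega>)) T - 1 = n \<and>
      (\<forall>i<n. (genus_age (genus_clock (\<lambda>i. X i \<omega>)) T (Suc i),
        genus_size (genus_clock (\<lambda>i. X i \<omega>)) (species_clock (\<lambda>i. X i \<omega>)) T (Suc i)) \<in> A i)} =
    ennreal (exp (- g * T)) * (\<Prod>i<n. age_size_measure g s T (A i))"
proof -
  note XM [measurable] = yule_familyD(4)[OF X]
  note [measurable] = measurable_num_genera[of "\<lambda>\<omega> i. X i \<omega>", OF XM] measurable_genus_age_size[of "\<lambda>\<omega> i. X i \<omega>", OF XM]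
  let ?num = "\<lambda>\<omega>. num_genera (genus_clock (\<lambda>i. X i \<omega>)) T"
  let ?val = "\<lambda>\<omega> i. (genus_age (genus_clock (\<lambda>i. X i \<omega>)) T (Suc i),
        genus_size (genus_clock (\<lambda>i. X i \<omega>)) (species_clock (\<lambda>i. X i \<omega>)) T (Suc i))"
  have ae: "AE \<omega> in M. \<forall>n B. planar_event n T (\<lambda>i. X i \<omega>) B \<longleftrightarrow> ?num \<omega> = Suc n \<and> (\<forall>i<n. ?val \<omega> i \<in> B i)"
    using AE_yule_family_pos[OF X g s]
  proof eventually_elim
    case (elim \<omega>)
    then show ?case using T by (intro allI planar_event_iff) (simp_all add: genus_clock_def)
  qed
  have pe: "emeasure M {\<omega> \<in> space M. ?num \<omega> = Suc n \<and> (\<forall>i<n. ?val \<omega> i \<in> B i)} =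
      ennreal (exp (- g * T)) * (\<Prod>i<n. age_size_measure g s T (B i))"
    if B [measurable]: "\<And>i. B i \<in> sets pair_space" for n B
  proof -
    have "emeasure M {\<omega> \<in> space M. ?num \<omega> = Suc n \<and> (\<forall>i<n. ?val \<omega> i \<in> B i)} =
        emeasure M {\<omega> \<in> space M. planar_event n T (\<lambda>i. X i \<omega>) B}"
    proof (rule emeasure_eq_AE)
      show "AE \<omega> in M. \<omega> \<in> {\<omega> \<in> space M. ?num \<omega> = Suc n \<and> (\<forall>i<n. ?val \<omega> i \<in> B i)} \<longleftrightarrow>
          \<omega> \<in> {\<omega> \<in> space M. planar_event n T (\<lambda>i. X i \<omega>) B}"
        using ae by eventually_elim simp
      show "{\<omega> \<in> space M. planar_event n T (\<lambda>i. X i \<omega>) B} \<in> events"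
        using pred_planar_event[of "\<lambda>\<omega> i. X i \<omega>" M "\<lambda>_. T" B n] by (simp add: pred_def)
    qed measurable
    then show ?thesis by (simp add: emeasure_planar_event[OF X g s T B])
  qed
  let ?q = "exp (- g * T)"
  have q: "0 < ?q" "?q \<le> 1" using g T by simp_all
  have "prob {\<omega> \<in> space M. ?num \<omega> = Suc n} = ?q * (1 - ?q) ^ n" for n
  proof -
    have "emeasure M {\<omega> \<in> space M. ?num \<omega> = Suc n} = ennreal ?q * (\<Prod>i<n. ennreal (1 - ?q))"
      using pe[of "\<lambda>_. UNIV" n] by (simp add: age_size_measure_UNIV[OF X g s T])
    also have "\<dots> = ennreal (?q * (1 - ?q) ^ n)"
      using q by (simp add: ennreal_mult ennreal_power)
    finally show ?thesis using q by (simp add: emeasure_eq_measure)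
  qed
  moreover have "(\<lambda>n. prob {\<omega> \<in> space M. ?num \<omega> = Suc n}) sums prob (\<Union>n. {\<omega> \<in> space M. ?num \<omega> = Suc n})"
    by (rule finite_measure_UNION) (auto simp: disjoint_family_on_def)
  moreover have "(\<lambda>n. ?q * (1 - ?q) ^ n) sums (?q * (1 / (1 - (1 - ?q))))"
    using q by (intro sums_mult geometric_sums) simp
  ultimately have "prob (\<Union>n. {\<omega> \<in> space M. ?num \<omega> = Suc n}) = 1"
    using sums_unique2 by fastforce
  then have "AE \<omega> in M. \<omega> \<in> (\<Union>n. {\<omega> \<in> space M. ?num \<omega> = Suc n})"
    by (rule AE_prob_1)
  then have "AE \<omega> in M. ?num \<omega> - 1 = n \<longleftrightarrow> ?num \<omega> = Suc n"
    by eventually_elim auto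
  then have "emeasure M {\<omega> \<in> space M. ?num \<omega> - 1 = n \<and> (\<forall>i<n. ?val \<omega> i \<in> A i)} =
      emeasure M {\<omega> \<in> space M. ?num \<omega> = Suc n \<and> (\<forall>i<n. ?val \<omega> i \<in> A i)}"
    using A by (intro emeasure_eq_AE) (auto elim!: AE_mp)
  then show ?thesis by (simp add: pe A)
qed

lemma pred_killing_index:
  fixes A' :: "nat \<Rightarrow> 'a \<Rightarrow> real"
  assumes [measurable]: "\<And>j. A' (Suc j) \<in> borel_measurable N"
  shows "Measurable.pred N (\<lambda>\<omega>. (LEAST j. 1 \<le> j \<and> T < A' j \<omega>) - 1 = n)"
proof -
  have "Measurable.pred N (\<lambda>\<omega>. 1 \<le> j \<and> T < A' j \<omega>)" for j
    by (cases j) auto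
  then have "(\<lambda>\<omega>. LEAST j. 1 \<le> j \<and> T < A' j \<omega>) \<in> measurable N (count_space UNIV)"
    by (rule measurable_Least)
  from measurable_compose[OF this, of "\<lambda>k. k - 1 = n"] show ?thesis by simp
qed

lemma (in prob_space) emeasure_killed_iid_rectangle:
  assumes g: "0 < g" and s: "0 < s"
    and ind: "indep_vars (\<lambda>_. pair_space) (\<lambda>j \<omega>. (A' j \<omega>, S' j \<omega>)) {1..}"
    and law: "\<And>j. 1 \<le> j \<Longrightarrow> distr M pair_space (\<lambda>\<omega>. (A' j \<omega>, S' j \<omega>)) = AS_law g s"
    and UNIV: "age_size_measure g s T UNIV = ennreal (1 - q)" and q: "0 < q" "q \<le> 1"
    and A: "\<And>i. A i \<in> sets pair_space"
  shows "emeasure M {\<omega> \<in> space M. (LEAST j. 1 \<le> j \<and> T < A' j \<omega>) - 1 = n \<and>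
      (\<forall>i<n. (A' (Suc i) \<omega>, S' (Suc i) \<omega>) \<in> A i)} = ennreal q * (\<Prod>i<n. age_size_measure g s T (A i))"
proof -
  let ?Z = "\<lambda>j \<omega>. (A' j \<omega>, S' j \<omega>)"
  note [measurable] = A
  have Z [measurable]: "?Z (Suc j) \<in> measurable M pair_space" for j
    using ind by (auto simp: indep_vars_def)
  have A' [measurable]: "A' (Suc j) \<in> borel_measurable M" for j
    using measurable_compose[OF Z measurable_fst] by simp
  have Z_le: "emeasure M {\<omega> \<in> space M. ?Z (Suc j) \<omega> \<in> B \<inter> {..T} \<times> UNIV} = age_size_measure g s T B"
    if B [measurable]: "B \<in> sets pair_space" for j B
  proof -
    have "emeasure M {\<omega> \<in> space M. ?Z (Suc j) \<omega> \<in> B \<inter> {..T} \<times> UNIV} =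
        emeasure (distr M pair_space (?Z (Suc j))) (B \<inter> {..T} \<times> UNIV)"
      by (subst emeasure_distr) (auto intro!: arg_cong[where f="emeasure M"])
    then show ?thesis by (simp add: law emeasure_AS_law[OF B g s])
  qed
  have le: "prob {\<omega> \<in> space M. A' (Suc j) \<omega> \<le> T} = 1 - q" for j
    using Z_le[of UNIV j] q by (simp add: UNIV emeasure_eq_measure)
  have gt: "prob {\<omega> \<in> space M. T < A' (Suc j) \<omega>} = q" for j
  proof -
    have "{\<omega> \<in> space M. T < A' (Suc j) \<omega>} = space M - {\<omega> \<in> space M. A' (Suc j) \<omega> \<le> T}" by auto
    then show ?thesis using prob_compl[of "{\<omega> \<in> space M. A' (Suc j) \<omega> \<le> T}"] le by simp
  qed
  have indep: "prob {\<omega> \<in> space M. \<forall>i<Suc n. ?Z (Suc i) \<omega> \<in> C i} = (\<Prod>i<Suc n. prob {\<omega> \<in> space M. ?Z (Suc i) \<omega> \<in> C i})"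
    if C: "\<And>i. C i \<in> sets pair_space" for C n
  proof -
    have "indep_vars (\<lambda>_. pair_space) (\<lambda>i. ?Z (Suc i)) {..<Suc n}"
      using indep_vars_reindex[OF ind, of Suc "{..<Suc n}"] by auto
    from indep_varsD_finite[OF this, of C]
    have "prob (\<Inter>i\<in>{..<Suc n}. ?Z (Suc i) -` C i \<inter> space M) = (\<Prod>i<Suc n. prob (?Z (Suc i) -` C i \<inter> space M))"
      using C by (simp add: lessThan_empty_iff)
    moreover have "(\<Inter>i\<in>{..<Suc n}. ?Z (Suc i) -` C i \<inter> space M) = {\<omega> \<in> space M. \<forall>i<Suc n. ?Z (Suc i) \<omega> \<in> C i}"
      by auto
    moreover have "?Z (Suc i) -` C i \<inter> space M = {\<omega> \<in> space M. ?Z (Suc i) \<omega> \<in> C i}" for i by auto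
    ultimately show ?thesis by (simp only:)
  qed
  have "prob {\<omega> \<in> space M. \<forall>i. A' (Suc i) \<omega> \<le> T} = 0"
  proof (rule antisym)
    show "prob {\<omega> \<in> space M. \<forall>i. A' (Suc i) \<omega> \<le> T} \<le> 0"
    proof (rule LIMSEQ_le_const)
      show "(\<lambda>n. (1 - q) ^ Suc n) \<longlonglongrightarrow> 0" using q by (intro LIMSEQ_Suc LIMSEQ_power_zero) simp
      have "prob {\<omega> \<in> space M. \<forall>i. A' (Suc i) \<omega> \<le> T} \<le> (1 - q) ^ Suc n" for n
      proof -
        have "prob {\<omega> \<in> space M. \<forall>i. A' (Suc i) \<omega> \<le> T} \<le> prob {\<omega> \<in> space M. \<forall>i<Suc n. ?Z (Suc i) \<omega> \<in> {..T} \<times> UNIV}"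
          by (rule finite_measure_mono) auto
        also have "\<dots> = (1 - q) ^ Suc n"
          by (subst indep) (auto simp: le)
        finally show ?thesis .
      qed
      then show "\<exists>N. \<forall>n\<ge>N. prob {\<omega> \<in> space M. \<forall>i. A' (Suc i) \<omega> \<le> T} \<le> (1 - q) ^ Suc n" by blast
    qed
  qed simp
  then have "AE \<omega> in M. \<not> (\<forall>i. A' (Suc i) \<omega> \<le> T)" by (subst (asm) prob_eq_0) (auto elim: AE_mp)
  then have ae: "AE \<omega> in M. (LEAST j. 1 \<le> j \<and> T < A' j \<omega>) - 1 = n \<longleftrightarrow>
      (\<forall>i<n. A' (Suc i) \<omega> \<le> T) \<and> T < A' (Suc n) \<omega>"
  proof eventually_elim
    case (elim \<omega>)
    define K where "K = (LEAST j. 1 \<le> j \<and> T < A' j \<omega>)"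
    have "\<exists>j. 1 \<le> j \<and> T < A' j \<omega>" using elim by (auto simp: not_le)
    then have K: "1 \<le> K" "T < A' K \<omega>" unfolding K_def by (metis (mono_tags, lifting) LeastI_ex)+
    have least: "A' j \<omega> \<le> T" if "1 \<le> j" "j < K" for j
      using not_less_Least[of j "\<lambda>j. 1 \<le> j \<and> T < A' j \<omega>"] that unfolding K_def by auto
    have "K - 1 = n \<longleftrightarrow> (\<forall>i<n. A' (Suc i) \<omega> \<le> T) \<and> T < A' (Suc n) \<omega>"
    proof
      assume "K - 1 = n"
      then have "K = Suc n" using K by simp
      then show "(\<forall>i<n. A' (Suc i) \<omega> \<le> T) \<and> T < A' (Suc n) \<omega>" using K least by auto
    next
      assume *: "(\<forall>i<n. A' (Suc i) \<omega> \<le> T) \<and> T < A' (Suc n) \<omega>"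
      have "\<not> Suc n < K" using least[of "Suc n"] * by auto
      moreover have "\<not> K < Suc n"
      proof
        assume "K < Suc n"
        then have "K - 1 < n" "Suc (K - 1) = K" using K by linarith+
        then have "A' K \<omega> \<le> T" using * by metis
        then show False using K by simp
      qed
      ultimately show "K - 1 = n" by simp
    qed
    then show ?case by (simp add: K_def)
  qed
  define C where "C i = (if i < n then A i \<inter> {..T} \<times> UNIV else {T<..} \<times> UNIV)" for i
  have C [measurable]: "C i \<in> sets pair_space" for i
    unfolding C_def by (cases "i < n") (simp_all add: A)
  have events: "Measurable.pred M (\<lambda>\<omega>. (LEAST j. 1 \<le> j \<and> T < A' j \<omega>) - 1 = n \<and> (\<forall>i<n. ?Z (Suc i) \<omega> \<in> A i))"
    by (intro pred_intros_logic pred_killing_index A') measurable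
  have "emeasure M {\<omega> \<in> space M. (LEAST j. 1 \<le> j \<and> T < A' j \<omega>) - 1 = n \<and> (\<forall>i<n. ?Z (Suc i) \<omega> \<in> A i)} =
      emeasure M {\<omega> \<in> space M. \<forall>i<Suc n. ?Z (Suc i) \<omega> \<in> C i}"
  proof (rule emeasure_eq_AE)
    show "AE \<omega> in M. \<omega> \<in> {\<omega> \<in> space M. (LEAST j. 1 \<le> j \<and> T < A' j \<omega>) - 1 = n \<and> (\<forall>i<n. ?Z (Suc i) \<omega> \<in> A i)} \<longleftrightarrow>
        \<omega> \<in> {\<omega> \<in> space M. \<forall>i<Suc n. ?Z (Suc i) \<omega> \<in> C i}"
      using ae by eventually_elim (auto simp: All_less_Suc C_def)
    show "{\<omega> \<in> space M. (LEAST j. 1 \<le> j \<and> T < A' j \<omega>) - 1 = n \<and> (\<forall>i<n. ?Z (Suc i) \<omega> \<in> A i)} \<in> events"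
      using events by (simp only: pred_def)
  qed measurable
  also have "\<dots> = ennreal (\<Prod>i<Suc n. prob {\<omega> \<in> space M. ?Z (Suc i) \<omega> \<in> C i})"
    unfolding emeasure_eq_measure by (subst indep[OF C]) (rule refl)
  also have "\<dots> = (\<Prod>i<Suc n. emeasure M {\<omega> \<in> space M. ?Z (Suc i) \<omega> \<in> C i})"
    by (simp only: emeasure_eq_measure prod_ennreal measure_nonneg)
  also have "\<dots> = (\<Prod>i<n. age_size_measure g s T (A i)) * ennreal q"
    using Z_le[OF A] gt by (simp add: C_def emeasure_eq_measure)
  finally show ?thesis by (simp add: mult.commute)
qed

theorem theorem1:
  fixes M :: "'a measure" and N :: "'b measure"
    and X :: "(nat list \<times> nat) + (nat list \<times> nat) \<Rightarrow> 'a \<Rightarrow> real"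
    and A' :: "nat \<Rightarrow> 'b \<Rightarrow> real" and S' :: "nat \<Rightarrow> 'b \<Rightarrow> nat"
    and g s T :: real
  assumes g: "0 < g" and s: "0 < s" and T: "0 < T"
    and M: "prob_space M"
    and X_indep: "prob_space.indep_vars M (\<lambda>_. borel) X UNIV"
    and X_gen: "\<And>p m. distributed M lborel (X (Inl (p, m))) (exponential_density g)"
    and X_spec: "\<And>u k. distributed M lborel (X (Inr (u, k))) (exponential_density (s * real (Suc k)))"
    and N: "prob_space N"
    and AS_indep: "prob_space.indep_vars N (\<lambda>_. pair_space) (\<lambda>j \<omega>. (A' j \<omega>, S' j \<omega>)) {1..}"
    and AS_law: "\<And>j. 1 \<le> j \<Longrightarrow> distr N pair_space (\<lambda>\<omega>. (A' j \<omega>, S' j \<omega>)) = AS_law g s"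
  shows "\<forall>n. \<forall>B \<in> sets (Pi\<^sub>M {..<n} (\<lambda>_. pair_space)).
    measure M {\<omega> \<in> space M.
        let E = (\<lambda>p m. X (Inl (p, m)) \<omega>); H = (\<lambda>u k. X (Inr (u, k)) \<omega>) in
        num_genera E T - 1 = n \<and>
        (\<lambda>i\<in>{..<n}. (genus_age E T (Suc i), genus_size E H T (Suc i))) \<in> B}
    = measure N {\<omega> \<in> space N.
        let K = (LEAST j. 1 \<le> j \<and> T < A' j \<omega>) in
        K - 1 = n \<and> (\<lambda>j\<in>{..<n}. (A' (Suc j) \<omega>, S' (Suc j) \<omega>)) \<in> B}"
proof (intro allI ballI)
  fix n and B :: "(nat \<Rightarrow> real \<times> nat) set"
  assume B: "B \<in> sets (Pi\<^sub>M {..<n} (\<lambda>_. pair_space))"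
  interpret M: prob_space M by fact
  interpret N: prob_space N by fact
  have X: "M.yule_family g s X"
    using X_indep X_gen X_spec by (simp add: M.yule_family_def)
  note XM [measurable] = M.yule_familyD(4)[OF X]
  note [measurable] = measurable_num_genera[of "\<lambda>\<omega> i. X i \<omega>", OF XM] measurable_genus_age_size[of "\<lambda>\<omega> i. X i \<omega>", OF XM]
  let ?E = "\<lambda>\<omega>. genus_clock (\<lambda>i. X i \<omega>)" and ?H = "\<lambda>\<omega>. species_clock (\<lambda>i. X i \<omega>)"
  have Z [measurable]: "(\<lambda>\<omega>. (A' (Suc j) \<omega>, S' (Suc j) \<omega>)) \<in> measurable N pair_space" for j
    using AS_indep by (auto simp: N.indep_vars_def)
  have A' [measurable]: "A' (Suc j) \<in> borel_measurable N" for j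
    using measurable_compose[OF Z measurable_fst] by simp
  have clocks: "(\<lambda>p m. X (Inl (p, m)) \<omega>) = ?E \<omega>" "(\<lambda>u k. X (Inr (u, k)) \<omega>) = ?H \<omega>" for \<omega>
    by (simp_all add: genus_clock_def species_clock_def fun_eq_iff)
  have q: "0 < exp (- g * T)" "exp (- g * T) \<le> 1" using g T by simp_all
  have "emeasure M {\<omega> \<in> space M. num_genera (?E \<omega>) T - 1 = n \<and>
        (\<lambda>i\<in>{..<n}. (genus_age (?E \<omega>) T (Suc i), genus_size (?E \<omega>) (?H \<omega>) T (Suc i))) \<in> B} =
      emeasure N {\<omega> \<in> space N. (LEAST j. 1 \<le> j \<and> T < A' j \<omega>) - 1 = n \<and>
        (\<lambda>j\<in>{..<n}. (A' (Suc j) \<omega>, S' (Suc j) \<omega>)) \<in> B}"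
  proof (rule emeasure_eqI_PiM_finite[OF M.finite_measure_axioms _ _ _ _ _ _ B])
    show "Measurable.pred N (\<lambda>\<omega>. (LEAST j. 1 \<le> j \<and> T < A' j \<omega>) - 1 = n)"
      by (rule pred_killing_index) (rule A')
    fix A :: "nat \<Rightarrow> (real \<times> nat) set"
    assume A: "\<And>i. i \<in> {..<n} \<Longrightarrow> A i \<in> sets pair_space"
    let ?A = "\<lambda>i. if i < n then A i else {}"
    have A': "?A i \<in> sets pair_space" for i using A by simp
    let ?val = "\<lambda>\<omega> i. (genus_age (?E \<omega>) T (Suc i), genus_size (?E \<omega>) (?H \<omega>) T (Suc i))"
    have "emeasure M {\<omega> \<in> space M. num_genera (?E \<omega>) T - 1 = n \<and> (\<forall>i\<in>{..<n}. restrict (?val \<omega>) {..<n} i \<in> A i)} =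
        emeasure M {\<omega> \<in> space M. num_genera (?E \<omega>) T - 1 = n \<and> (\<forall>i<n. ?val \<omega> i \<in> ?A i)}"
      by (rule arg_cong[where f="emeasure M"]) auto
    also have "\<dots> = ennreal (exp (- g * T)) * (\<Prod>i<n. age_size_measure g s T (?A i))"
      by (rule M.emeasure_genera_rectangle[OF X g s less_imp_le[OF T] A'])
    also have "\<dots> = emeasure N {\<omega> \<in> space N. (LEAST j. 1 \<le> j \<and> T < A' j \<omega>) - 1 = n \<and>
        (\<forall>i<n. (A' (Suc i) \<omega>, S' (Suc i) \<omega>) \<in> ?A i)}"
      by (rule N.emeasure_killed_iid_rectangle[OF g s AS_indep AS_law
          M.age_size_measure_UNIV[OF X g s less_imp_le[OF T]] q A', symmetric])
    also have "\<dots> = emeasure N {\<omega> \<in> space N. (LEAST j. 1 \<le> j \<and> T < A' j \<omega>) - 1 = n \<and>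
        (\<forall>i\<in>{..<n}. (\<lambda>j\<in>{..<n}. (A' (Suc j) \<omega>, S' (Suc j) \<omega>)) i \<in> A i)}"
      by (rule arg_cong[where f="emeasure N"]) auto
    finally show "emeasure M {\<omega> \<in> space M. num_genera (?E \<omega>) T - 1 = n \<and> (\<forall>i\<in>{..<n}. restrict (?val \<omega>) {..<n} i \<in> A i)} =
        emeasure N {\<omega> \<in> space N. (LEAST j. 1 \<le> j \<and> T < A' j \<omega>) - 1 = n \<and>
        (\<forall>i\<in>{..<n}. (\<lambda>j\<in>{..<n}. (A' (Suc j) \<omega>, S' (Suc j) \<omega>)) i \<in> A i)}" .
  qed (auto intro!: measurable_restrict)
  then show "measure M {\<omega> \<in> space M.
        let E = (\<lambda>p m. X (Inl (p, m)) \<omega>); H = (\<lambda>u k. X (Inr (u, k)) \<omega>) in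
        num_genera E T - 1 = n \<and>
        (\<lambda>i\<in>{..<n}. (genus_age E T (Suc i), genus_size E H T (Suc i))) \<in> B}
    = measure N {\<omega> \<in> space N.
        let K = (LEAST j. 1 \<le> j \<and> T < A' j \<omega>) in
        K - 1 = n \<and> (\<lambda>j\<in>{..<n}. (A' (Suc j) \<omega>, S' (Suc j) \<omega>)) \<in> B}"
    unfolding Let_def clocks by (simp add: measure_def)
qed

end
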